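(* Let $n\ge2$, let $F_n$ be the free group with free basis $A=\{a_1,\ldots,a_n\}$, and let $s\in F_n$ satisfy $\#^{\pm}_{a_i}(s)\le 2$ for $1\le i\le n$. If $\mathrm{Cay}(F_n;A^{\pm1}\cup\{s^{\pm1}\})$ has a hamiltonian circle, then $\mathrm{Cay}(F_n;\{s^{\pm1}\})$ is the only hamiltonian circle in this Cayley graph.
   Context: For $a\in A$ and $g\in F_n$, $\#^{\pm}_a(g)$ is the number of occurrences of $a$ plus the number of occurrences of $a^{-1}$ in the reduced word representing $g$. For symmetric $S\subseteq G$, $\mathrm{Cay}(G;S)$ has vertex set $G$, with $x$ adjacent to $y$ iff $x^{-1}y\in S$. For a connected locally finite graph $X$, $|X|$ is its Freudenthal compactification (add one point per end), and a hamiltonian circle is a subspace of $|X|$ homeomorphic to $S^1$ containing all vertices, identified with the spanning 2-regular subgraph it meets $X$ in. *)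

theory Defs
  imports "HOL-Analysis.Analysis" "HOL-Algebra.Group"
begin

section \<open>Free groups\<close>

text \<open>The letter \<open>(a, True)\<close> stands for the generator \<open>a\<close> and \<open>(a, False)\<close> for its inverse.
  The free group on \<open>A\<close> is modelled on the reduced words over \<open>A\<close> and their inverses.\<close>

type_synonym 'a word = "('a \<times> bool) list"

definition linv :: "'a \<times> bool \<Rightarrow> 'a \<times> bool" where
  "linv x = (fst x, \<not> snd x)"

definition reduced :: "'a word \<Rightarrow> bool" where
  "reduced w \<longleftrightarrow> successively (\<lambda>x y. y \<noteq> linv x) w"

fun cons_reduce :: "'a \<times> bool \<Rightarrow> 'a word \<Rightarrow> 'a word" where
  "cons_reduce x [] = [x]"
| "cons_reduce x (y # w) = (if y = linv x then w else x # y # w)"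

definition free_reduce :: "'a word \<Rightarrow> 'a word" where
  "free_reduce w = foldr cons_reduce w []"

definition free_group :: "'a set \<Rightarrow> 'a word monoid" where
  "free_group A =
     \<lparr>carrier = {w. reduced w \<and> fst ` set w \<subseteq> A},
      mult = (\<lambda>u v. free_reduce (u @ v)),
      one = []\<rparr>"

definition gen :: "'a \<Rightarrow> 'a word" where
  "gen a = [(a, True)]"

definition occ :: "'a \<Rightarrow> 'a word \<Rightarrow> nat" where
  "occ a g = count_list g (a, True) + count_list g (a, False)"

lemma linv_linv [simp]: "linv (linv x) = x"
  by (simp add: linv_def)

lemma linv_neq [simp]: "linv x \<noteq> x" "x \<noteq> linv x"
  by (auto simp: linv_def prod_eq_iff)

lemma reduced_Nil [simp]: "reduced []"
  by (simp add: reduced_def)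

lemma reduced_Cons: "reduced (x # w) \<longleftrightarrow> reduced w \<and> (w = [] \<or> hd w \<noteq> linv x)"
  by (cases w) (auto simp: reduced_def)

lemma reduced_cons_reduce: "reduced w \<Longrightarrow> reduced (cons_reduce x w)"
  by (cases w) (auto simp: reduced_Cons)

lemma reduced_foldr: "reduced w \<Longrightarrow> reduced (foldr cons_reduce u w)"
  by (induction u) (auto simp: reduced_cons_reduce)

lemma cons_reduce_cancel: "reduced w \<Longrightarrow> cons_reduce x (cons_reduce (linv x) w) = w"
  by (cases w; cases "tl w") (auto simp: reduced_Cons)

lemma foldr_cons_reduce:
  assumes "reduced z"
  shows "foldr cons_reduce (cons_reduce x w) z = cons_reduce x (foldr cons_reduce w z)"
  using assms by (cases w) (auto simp: cons_reduce_cancel reduced_foldr)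

lemma foldr_free_reduce:
  assumes "reduced z"
  shows "foldr cons_reduce (free_reduce w) z = foldr cons_reduce w z"
  using assms by (induction w) (auto simp: free_reduce_def foldr_cons_reduce)

lemma free_reduce_reduced: "reduced w \<Longrightarrow> free_reduce w = w"
proof (induction w)
  case (Cons x w)
  then show ?case by (cases w) (auto simp: free_reduce_def reduced_Cons)
qed (simp add: free_reduce_def)

lemma set_free_reduce: "fst ` set (free_reduce w) \<subseteq> fst ` set w"
proof (induction w)
  case (Cons x w)
  have "fst ` set (cons_reduce x v) \<subseteq> insert (fst x) (fst ` set v)" for v
    by (cases v) auto
  from subset_trans[OF this insert_mono[OF Cons]] show ?case
    by (simp add: free_reduce_def)
qed (simp add: free_reduce_def)

lemma free_reduce_inverse: "free_reduce (map linv (rev w) @ w) = []"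
proof (induction w)
  case (Cons x w)
  have "reduced (foldr cons_reduce w [])"
    by (simp add: reduced_foldr)
  then show ?case
    using Cons cons_reduce_cancel[of "foldr cons_reduce w []" "linv x"]
    by (simp add: free_reduce_def)
qed (simp add: free_reduce_def)

lemma reduced_inverse: "reduced w \<Longrightarrow> reduced (map linv (rev w))"
proof -
  assume w: "reduced w"
  have "successively (\<lambda>x y. linv x \<noteq> linv (linv y)) w"
    using w unfolding reduced_def by (rule successively_mono) auto
  then show ?thesis
    unfolding reduced_def by (simp add: successively_map successively_rev)
qed

lemma free_group_group: "group (free_group A)"
proof (rule groupI)
  fix x y z
  assume x: "x \<in> carrier (free_group A)"
  assume y: "y \<in> carrier (free_group A)"
  show "x \<otimes>\<^bsub>free_group A\<^esub> y \<in> carrier (free_group A)"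
  proof -
    have "fst ` set (free_reduce (x @ y)) \<subseteq> A"
      using x y
      by (intro subset_trans[OF set_free_reduce]) (simp add: free_group_def image_Un)
    then show ?thesis
      by (simp add: free_group_def) (simp add: free_reduce_def reduced_foldr)
  qed
  assume z: "z \<in> carrier (free_group A)"
  show "x \<otimes>\<^bsub>free_group A\<^esub> y \<otimes>\<^bsub>free_group A\<^esub> z = x \<otimes>\<^bsub>free_group A\<^esub> (y \<otimes>\<^bsub>free_group A\<^esub> z)"
  proof -
    have "foldr cons_reduce (free_reduce (x @ y)) (foldr cons_reduce z [])
        = foldr cons_reduce (x @ y) (foldr cons_reduce z [])"
      by (rule foldr_free_reduce) (simp add: reduced_foldr)
    moreover have "foldr cons_reduce (free_reduce (y @ z)) [] = foldr cons_reduce (y @ z) []"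
      by (rule foldr_free_reduce) simp
    ultimately show ?thesis
      by (simp add: free_group_def free_reduce_def)
  qed
next
  fix x assume x: "x \<in> carrier (free_group A)"
  show "\<one>\<^bsub>free_group A\<^esub> \<otimes>\<^bsub>free_group A\<^esub> x = x"
    using x by (simp add: free_group_def free_reduce_reduced)
  show "\<exists>y\<in>carrier (free_group A). y \<otimes>\<^bsub>free_group A\<^esub> x = \<one>\<^bsub>free_group A\<^esub>"
  proof
    have "fst ` set (map linv (rev x)) = fst ` set x"
      by (simp add: image_image linv_def)
    then show "map linv (rev x) \<in> carrier (free_group A)"
      using x reduced_inverse[of x] by (simp add: free_group_def)
    show "map linv (rev x) \<otimes>\<^bsub>free_group A\<^esub> x = \<one>\<^bsub>free_group A\<^esub>"
      by (simp add: free_group_def free_reduce_inverse)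
  qed
qed (simp add: free_group_def)


section \<open>Graphs and Cayley graphs\<close>

record 'v graph =
  verts :: "'v set"
  adj :: "'v \<Rightarrow> 'v \<Rightarrow> bool"

definition cayley :: "('v, 'b) monoid_scheme \<Rightarrow> 'v set \<Rightarrow> 'v graph" where
  "cayley G S =
     \<lparr>verts = carrier G,
      adj = (\<lambda>x y. x \<in> carrier G \<and> y \<in> carrier G \<and> inv\<^bsub>G\<^esub> x \<otimes>\<^bsub>G\<^esub> y \<in> S)\<rparr>"

definition with_inverses :: "('v, 'b) monoid_scheme \<Rightarrow> 'v set \<Rightarrow> 'v set" where
  "with_inverses G S = S \<union> (\<lambda>x. inv\<^bsub>G\<^esub> x) ` S"


section \<open>Ends\<close>

definition same_component :: "'v graph \<Rightarrow> 'v set \<Rightarrow> 'v \<Rightarrow> 'v \<Rightarrow> bool" where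
  "same_component X S u v \<longleftrightarrow> u \<in> verts X - S \<and> v \<in> verts X - S \<and>
     (\<lambda>x y. adj X x y \<and> x \<in> verts X - S \<and> y \<in> verts X - S)\<^sup>*\<^sup>* u v"

definition comps :: "'v graph \<Rightarrow> 'v set \<Rightarrow> 'v set set" where
  "comps X S = {{v. same_component X S u v} |u. u \<in> verts X - S}"

definition ray :: "'v graph \<Rightarrow> (nat \<Rightarrow> 'v) \<Rightarrow> bool" where
  "ray X r \<longleftrightarrow> inj r \<and> range r \<subseteq> verts X \<and> (\<forall>i. adj X (r i) (r (Suc i)))"

definition ray_equiv :: "'v graph \<Rightarrow> (nat \<Rightarrow> 'v) \<Rightarrow> (nat \<Rightarrow> 'v) \<Rightarrow> bool" where
  "ray_equiv X r r' \<longleftrightarrow>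
     (\<forall>S. finite S \<and> S \<subseteq> verts X \<longrightarrow>
        (\<exists>C\<in>comps X S. (\<forall>\<^sub>F i in sequentially. r i \<in> C) \<and> (\<forall>\<^sub>F i in sequentially. r' i \<in> C)))"

definition ends :: "'v graph \<Rightarrow> (nat \<Rightarrow> 'v) set set" where
  "ends X = {{r'. ray X r' \<and> ray_equiv X r r'} |r. ray X r}"

definition ends_in :: "'v graph \<Rightarrow> 'v set \<Rightarrow> (nat \<Rightarrow> 'v) set set" where
  "ends_in X C = {\<omega> \<in> ends X. \<forall>r\<in>\<omega>. \<forall>\<^sub>F i in sequentially. r i \<in> C}"


section \<open>The Freudenthal compactification\<close>

text \<open>Points of the 1-complex of a graph are given by their barycentric coordinates: a vertex \<open>v\<close> is
  the indicator function of \<open>{v}\<close>, and the points of an edge \<open>uv\<close> are the convex combinations of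
  its two endpoints. A loop at \<open>v\<close> (in a Cayley graph this only arises from the identity element)
  contributes nothing but \<open>v\<close> itself, so loops are ignored. The point set of a subgraph is
  literally a subset of the point set of the graph.\<close>

datatype 'v fpoint = GraphPoint "'v \<Rightarrow> real" | End "(nat \<Rightarrow> 'v) set"

definition vertex_point :: "'v \<Rightarrow> 'v fpoint" where
  "vertex_point v = GraphPoint (indicator {v})"

definition edge_point :: "'v \<Rightarrow> 'v \<Rightarrow> real \<Rightarrow> 'v fpoint" where
  "edge_point u v t = GraphPoint (\<lambda>w. (1 - t) * indicator {u} w + t * indicator {v} w)"

definition graph_points :: "'v graph \<Rightarrow> 'v fpoint set" where
  "graph_points X = vertex_point ` verts X \<union>
     {edge_point u v t |u v t. u \<in> verts X \<and> v \<in> verts X \<and> adj X u v \<and> t \<in> {0..1}}"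

text \<open>A set is open in the 1-complex iff its trace on every edge is relatively open. For locally finite
  graphs this agrees with the topology given by metric balls.\<close>

definition graph_open :: "'v graph \<Rightarrow> 'v fpoint set \<Rightarrow> bool" where
  "graph_open X U \<longleftrightarrow> U \<subseteq> graph_points X \<and>
     (\<forall>u\<in>verts X. \<forall>v\<in>verts X. adj X u v \<longrightarrow>
        openin (top_of_set {0..1}) {t \<in> {0..1}. edge_point u v t \<in> U})"

text \<open>For a component \<open>C\<close> of \<open>X - S\<close>, the condition on \<open>p\<close> describes all points of \<open>C\<close> together with
  the inner points of the edges between \<open>C\<close> and \<open>S\<close>. Basic neighbourhoods of ends containing only
  small pieces of these edges give the same topology, since \<open>S\<close> can be enlarged by its finitely
  many neighbours.\<close>

definition end_nbhd :: "'v graph \<Rightarrow> 'v set \<Rightarrow> 'v fpoint set" where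
  "end_nbhd X C = {GraphPoint p |p. GraphPoint p \<in> graph_points X \<and> (\<exists>w\<in>C. p w \<noteq> 0)} \<union>
     End ` ends_in X C"

definition freudenthal :: "'v graph \<Rightarrow> 'v fpoint topology" where
  "freudenthal X = topology_generated_by
     ({U. graph_open X U} \<union> {end_nbhd X C |S C. finite S \<and> S \<subseteq> verts X \<and> C \<in> comps X S})"

lemma topspace_freudenthal:
  assumes sym: "symp (adj X)"
  shows "topspace (freudenthal X) = graph_points X \<union> End ` ends X"
proof
  show "topspace (freudenthal X) \<subseteq> graph_points X \<union> End ` ends X"
    by (auto simp: freudenthal_def graph_open_def end_nbhd_def ends_in_def)
next
  have "graph_open X (graph_points X)"
  proof -
    have "{t \<in> {0..1}. edge_point u v t \<in> graph_points X} = {0..1}"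
      if "u \<in> verts X" "v \<in> verts X" "adj X u v" for u v
      using that by (auto simp: graph_points_def)
    then show ?thesis by (auto simp: graph_open_def)
  qed
  then have "graph_points X \<subseteq> topspace (freudenthal X)"
    by (auto simp: freudenthal_def)
  moreover have "End \<omega> \<in> topspace (freudenthal X)" if \<omega>: "\<omega> \<in> ends X" for \<omega>
  proof -
    obtain r where r: "ray X r" and \<omega>_eq: "\<omega> = {r'. ray X r' \<and> ray_equiv X r r'}"
      using \<omega> by (auto simp: ends_def)
    define C where "C = {v. same_component X {} (r 0) v}"
    have r0: "r i \<in> verts X" for i
      using r by (auto simp: ray_def)
    then have C: "C \<in> comps X {}"
      by (auto simp: comps_def C_def)
    have r_in: "r i \<in> C" for i
    proof (induction i)
      case 0
      then show ?case using r0 by (simp add: C_def same_component_def)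
    next
      case (Suc i)
      moreover have "adj X (r i) (r (Suc i))"
        using r by (simp add: ray_def)
      ultimately show ?case
        using r0 unfolding C_def same_component_def
        by (auto intro: rtranclp.rtrancl_into_rtrancl)
    qed
    have "\<forall>\<^sub>F i in sequentially. r' i \<in> C" if r': "r' \<in> \<omega>" for r'
    proof -
      have "ray_equiv X r r'"
        using r' \<omega>_eq by simp
      then obtain D where D: "D \<in> comps X {}" "\<forall>\<^sub>F i in sequentially. r i \<in> D"
        "\<forall>\<^sub>F i in sequentially. r' i \<in> D"
        unfolding ray_equiv_def by (meson empty_subsetI finite.emptyI)
      obtain i where i: "r i \<in> D"
        using D(2) by (auto simp: eventually_sequentially)
      obtain u where u: "D = {v. same_component X {} u v}"
        using D(1) by (auto simp: comps_def)
      have "same_component X {} u (r i)"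
        using i u by simp
      moreover have R: "symp (\<lambda>x y. adj X x y \<and> x \<in> verts X - {} \<and> y \<in> verts X - {})"
        using sym by (auto simp: symp_def)
      ultimately have "same_component X {} (r i) u"
        using sympD[OF symp_rtranclp[OF R]] unfolding same_component_def by blast
      then have "D \<subseteq> C"
        using r_in[of i] u unfolding C_def same_component_def
        by (auto intro: rtranclp_trans)
      then show ?thesis
        using D(3) by (auto elim: eventually_mono)
    qed
    then have "End \<omega> \<in> end_nbhd X C"
      using \<omega> by (auto simp: end_nbhd_def ends_in_def)
    moreover have "openin (freudenthal X) (end_nbhd X C)"
      unfolding freudenthal_def using C
      by (intro topology_generated_by_Basis) auto
    ultimately show ?thesis
      using openin_subset by blast
  qed
  ultimately show "graph_points X \<union> End ` ends X \<subseteq> topspace (freudenthal X)"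
    by auto
qed


section \<open>Hamiltonian circles\<close>

definition hamiltonian_circle :: "'v graph \<Rightarrow> 'v fpoint set \<Rightarrow> bool" where
  "hamiltonian_circle X C \<longleftrightarrow> C \<subseteq> topspace (freudenthal X) \<and> vertex_point ` verts X \<subseteq> C \<and>
     subtopology (freudenthal X) C homeomorphic_space top_of_set (sphere (0::complex) 1)"

end

theory Submission
  imports Defs
begin

text \<open>Removing an edge \<open>{g, g x}\<close> of the Cayley tree of \<open>A\<close> splits the vertices of \<open>X\<close> into two
  sides. The edges of \<open>X\<close> between them are \<open>{g, g x}\<close> and at most two edges \<open>{h, h s}\<close>, since the
  tree path from \<open>h\<close> to \<open>h s\<close> spells \<open>s\<close>. A Hamiltonian circle uses at least two of these at most
  three edges, and at most two edges at each vertex; these two facts force all edges \<open>{h, h s}\<close> to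
  be used, and then no others are. Finally the circle is compact and contains all vertices, hence
  it contains all ends.\<close>


section \<open>Ends and components\<close>

text \<open>The obstacle is that a circle in |X| may run through infinitely many ends, so it cannot
  be followed edge by edge. Topology enters only through real-valued functions: every vertex set
  \<open>P\<close> with finite boundary gives a continuous function on |X| that is 0 or 1 at
  vertices and ends and linear on edges. Composed with a periodic parametrisation of the circle, it
  reduces cut crossings, degrees and the presence of ends to the intermediate value theorem and
  limits of real sequences. The bound \<open>n \<ge> 2\<close> makes \<open>s\<close> have at least
  two letters, so that the tree path it spells has an inner vertex at which the degree bound can be
  contradicted.\<close>

definition boundary :: "'v graph \<Rightarrow> 'v set \<Rightarrow> 'v set" where
  "boundary X P = {u. \<exists>v. (adj X u v \<or> adj X v u) \<and> (u \<in> P) \<noteq> (v \<in> P)}"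

locale locally_finite_graph =
  fixes X :: "'v graph"
  assumes symp_adj: "symp (adj X)"
    and adj_verts: "adj X u v \<Longrightarrow> u \<in> verts X"
    and finite_adj: "finite {v. adj X u v}"
begin

lemma adj_sym: "adj X u v \<Longrightarrow> adj X v u"
  using symp_adj by (rule sympD)

lemma adj_verts2: "adj X u v \<Longrightarrow> v \<in> verts X"
  using adj_verts adj_sym by blast

lemma same_component_sym: "same_component X S u v \<Longrightarrow> same_component X S v u"
proof -
  have "symp (\<lambda>x y. adj X x y \<and> x \<in> verts X - S \<and> y \<in> verts X - S)"
    using adj_sym by (auto simp: symp_def)
  from sympD[OF symp_rtranclp[OF this]] show "same_component X S u v \<Longrightarrow> same_component X S v u"
    unfolding same_component_def by blast
qed

lemma same_component_trans:
  "same_component X S u v \<Longrightarrow> same_component X S v w \<Longrightarrow> same_component X S u w"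
  unfolding same_component_def by (meson rtranclp_trans)

lemma comps_eq:
  assumes "C \<in> comps X S" "D \<in> comps X S" "z \<in> C" "z \<in> D"
  shows "C = D"
proof -
  obtain u v where "C = {w. same_component X S u w}" "D = {w. same_component X S v w}"
    using assms by (auto simp: comps_def)
  then show ?thesis
    using assms same_component_sym same_component_trans by blast
qed

lemma comps_eq_eventually:
  assumes "C \<in> comps X S" "D \<in> comps X S"
    "\<forall>\<^sub>F i in sequentially. r i \<in> C" "\<forall>\<^sub>F i in sequentially. r i \<in> D"
  shows "C = D"
proof -
  have "\<forall>\<^sub>F i in sequentially. r i \<in> C \<and> r i \<in> D"
    using assms by (auto intro: eventually_conj)
  then obtain i where "r i \<in> C" "r i \<in> D"
    unfolding eventually_sequentially by blast
  then show ?thesis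
    using comps_eq assms by metis
qed

lemma comps_subset: "C \<in> comps X S \<Longrightarrow> C \<subseteq> verts X - S"
  by (auto simp: comps_def same_component_def)

lemma comps_adj_closed:
  assumes "C \<in> comps X S" "u \<in> C" "adj X u v" "v \<notin> S"
  shows "v \<in> C"
proof -
  obtain z where z: "C = {w. same_component X S z w}"
    using assms by (auto simp: comps_def)
  have "same_component X S u v"
    using assms comps_subset[OF assms(1)] adj_verts2[OF assms(3)]
    unfolding same_component_def by (auto intro!: r_into_rtranclp)
  then show ?thesis
    using assms(2) z same_component_trans by blast
qed

text \<open>\<open>boundary\<close> contains both ends of every edge across \<open>P\<close>, so a
  walk avoiding it never changes sides. This is why the boundary is a vertex set: it can serve as
  the deleted set of \<open>comps\<close>.\<close>

lemma comps_side:
  assumes "C \<in> comps X S" "boundary X P \<subseteq> S"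
  shows "C \<subseteq> P \<or> C \<inter> P = {}"
proof -
  obtain z where z: "C = {w. same_component X S z w}"
    using assms by (auto simp: comps_def)
  have "(z \<in> P) = (w \<in> P)"
    if "(\<lambda>x y. adj X x y \<and> x \<in> verts X - S \<and> y \<in> verts X - S)\<^sup>*\<^sup>* z w" for w
    using that
  proof (induction rule: rtranclp_induct)
    case (step y w)
    then show ?case
      using assms(2) by (auto simp: boundary_def)
  qed simp
  then show ?thesis
    unfolding z same_component_def by blast
qed

text \<open>An edge leaving \<open>C\<close> must end in \<open>S\<close>. The finiteness makes the
  cut function of a component continuous, which later tells ends apart.\<close>

lemma finite_boundary_comps:
  assumes "C \<in> comps X S" "finite S"
  shows "finite (boundary X C)"
proof (rule finite_subset)
  show "boundary X C \<subseteq> S \<union> (\<Union>u\<in>S. {v. adj X u v})"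
    unfolding boundary_def using comps_adj_closed[OF assms(1)] adj_sym by blast
qed (use assms finite_adj in auto)

lemma finite_boundary_vertex: "finite (boundary X {w})"
proof (rule finite_subset)
  show "boundary X {w} \<subseteq> insert w {v. adj X w v}"
    unfolding boundary_def using adj_sym by blast
qed (use finite_adj in auto)

lemma boundary_subset_verts: "boundary X P \<subseteq> verts X"
  using adj_verts adj_verts2 by (auto simp: boundary_def)

text \<open>An injective sequence leaves the finite set \<open>S\<close> for good, and from then on
  consecutive vertices stay in one component.\<close>

lemma ray_comps:
  assumes r: "ray X r" and S: "finite S"
  shows "\<exists>C\<in>comps X S. \<forall>\<^sub>F i in sequentially. r i \<in> C"
proof -
  have "finite (r -` S)"
    using r S by (auto simp: ray_def intro: finite_vimageI)
  then obtain N where "\<forall>i\<in>r -` S. i < N"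
    using finite_nat_set_iff_bounded by blast
  then have N: "r i \<notin> S" if "i \<ge> N" for i
    using that by (metis linorder_not_less vimageI2)
  have adj: "adj X (r i) (r (Suc i))" and verts: "r i \<in> verts X" for i
    using r by (auto simp: ray_def)
  have C: "{v. same_component X S (r N) v} \<in> comps X S"
    using N[of N] verts by (auto simp: comps_def)
  have "r i \<in> {v. same_component X S (r N) v}" if "i \<ge> N" for i
    using that
  proof (induction i rule: dec_induct)
    case base
    then show ?case using N verts by (simp add: same_component_def)
  next
    case (step i)
    then show ?case
      using comps_adj_closed[OF C, of "r i" "r (Suc i)"] adj N by auto
  qed
  then have "\<forall>\<^sub>F i in sequentially. r i \<in> {v. same_component X S (r N) v}"
    unfolding eventually_sequentially by blast
  with C show ?thesis by blast
qed

lemma ray_equiv_comps: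
  assumes "ray_equiv X r r'" "finite S" "S \<subseteq> verts X" "C \<in> comps X S"
    "\<forall>\<^sub>F i in sequentially. r i \<in> C"
  shows "\<forall>\<^sub>F i in sequentially. r' i \<in> C"
proof -
  obtain D where "D \<in> comps X S" "\<forall>\<^sub>F i in sequentially. r i \<in> D" "\<forall>\<^sub>F i in sequentially. r' i \<in> D"
    using assms(1-3) by (auto simp: ray_equiv_def)
  then show ?thesis
    using comps_eq_eventually[OF assms(4) _ assms(5)] by blast
qed

lemma ends_in_comps:
  assumes "\<omega> \<in> ends X" "finite S" "S \<subseteq> verts X"
  shows "\<exists>C\<in>comps X S. \<omega> \<in> ends_in X C"
proof -
  obtain r where r: "ray X r" "\<omega> = {r'. ray X r' \<and> ray_equiv X r r'}"
    using assms by (auto simp: ends_def)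
  obtain C where C: "C \<in> comps X S" "\<forall>\<^sub>F i in sequentially. r i \<in> C"
    using ray_comps[OF r(1) assms(2)] by blast
  then have "\<omega> \<in> ends_in X C"
    using assms r(2) ray_equiv_comps[OF _ assms(2,3) C] by (auto simp: ends_in_def)
  then show ?thesis using C by blast
qed

text \<open>Ends are separated by finite vertex sets. The one-way hypothesis is enough, since for
  each \<open>S\<close> the end \<open>\<omega>\<close> does live in some component, which then
  contains both ends eventually.\<close>

lemma ends_eqI:
  assumes \<omega>: "\<omega> \<in> ends X" and \<omega>': "\<omega>' \<in> ends X"
    and in_comps: "\<And>S C. finite S \<Longrightarrow> S \<subseteq> verts X \<Longrightarrow> C \<in> comps X S \<Longrightarrow>
      \<omega> \<in> ends_in X C \<Longrightarrow> \<omega>' \<in> ends_in X C"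
  shows "\<omega> = \<omega>'"
proof -
  have sub: "\<omega>1 \<subseteq> \<omega>2"
    if \<omega>1: "\<omega>1 \<in> ends X" and \<omega>2: "\<omega>2 \<in> ends X" and in_comps: "\<And>S. finite S \<Longrightarrow> S \<subseteq> verts X \<Longrightarrow>
      \<exists>C\<in>comps X S. \<omega>1 \<in> ends_in X C \<and> \<omega>2 \<in> ends_in X C" for \<omega>1 \<omega>2
  proof
    fix r' assume r': "r' \<in> \<omega>1"
    obtain r where r: "ray X r" "\<omega>2 = {r'. ray X r' \<and> ray_equiv X r r'}"
      using \<omega>2 by (auto simp: ends_def)
    have "ray_equiv X r r"
      using ray_comps[OF r(1)] by (simp add: ray_equiv_def)
    then have "r \<in> \<omega>2" using r by simp
    have "ray_equiv X r r'"
      unfolding ray_equiv_def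
    proof (intro allI impI)
      fix S assume "finite S \<and> S \<subseteq> verts X"
      then obtain C where "C \<in> comps X S" "\<omega>1 \<in> ends_in X C" "\<omega>2 \<in> ends_in X C"
        using in_comps by blast
      then show "\<exists>C\<in>comps X S. (\<forall>\<^sub>F i in sequentially. r i \<in> C) \<and> (\<forall>\<^sub>F i in sequentially. r' i \<in> C)"
        using r' \<open>r \<in> \<omega>2\<close> by (auto simp: ends_in_def)
    qed
    moreover have "ray X r'"
      using r' \<omega>1 by (auto simp: ends_def)
    ultimately show "r' \<in> \<omega>2" using r by simp
  qed
  have "\<exists>C\<in>comps X S. \<omega> \<in> ends_in X C \<and> \<omega>' \<in> ends_in X C"
    if "finite S" "S \<subseteq> verts X" for S
    using ends_in_comps[OF \<omega> that] in_comps[OF that] by blast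
  then show ?thesis
    using sub[OF \<omega> \<omega>'] sub[OF \<omega>' \<omega>] by (meson subset_antisym)
qed

lemma ends_nonempty: "\<omega> \<in> ends X \<Longrightarrow> \<exists>r\<in>\<omega>. ray X r"
proof -
  assume "\<omega> \<in> ends X"
  then obtain r where r: "ray X r" "\<omega> = {r'. ray X r' \<and> ray_equiv X r r'}"
    by (auto simp: ends_def)
  then have "ray_equiv X r r"
    using ray_comps[OF r(1)] by (simp add: ray_equiv_def)
  with r show ?thesis by blast
qed

end


section \<open>Continuous functions from cuts\<close>

text \<open>The piecewise linear extension of the indicator function of \<open>P\<close> to |X|.
  Summing over the support of \<open>p\<close> keeps the sum finite for points of the graph; a sum
  over an infinite \<open>P\<close> would default to 0. For \<open>P = {w}\<close> it is the
  barycentric coordinate at \<open>w\<close>.\<close>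

definition cut_fun :: "'v graph \<Rightarrow> 'v set \<Rightarrow> 'v fpoint \<Rightarrow> real" where
  "cut_fun X P z = (case z of
     GraphPoint p \<Rightarrow> (\<Sum>w | p w \<noteq> 0 \<and> w \<in> P. p w)
   | End \<omega> \<Rightarrow> of_bool (\<omega> \<in> ends_in X P))"

lemma cut_fun_edge_point:
  "cut_fun X P (edge_point u v t) = (1 - t) * indicator P u + t * indicator P v"
proof -
  define p where "p = (\<lambda>w. (1 - t) * indicator {u} w + t * indicator {v} w :: real)"
  have "(\<Sum>w | p w \<noteq> 0 \<and> w \<in> P. p w) = (\<Sum>w\<in>{u, v} \<inter> P. p w)"
    by (rule sum.mono_neutral_left) (auto simp: p_def indicator_def split: if_splits)
  also have "\<dots> = (1 - t) * indicator P u + t * indicator P v"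
    by (cases "u \<in> P"; cases "v \<in> P"; cases "u = v") (auto simp: p_def)
  finally show ?thesis
    by (simp add: cut_fun_def edge_point_def p_def)
qed

lemma vertex_point_eq_edge_point: "vertex_point v = edge_point v v t"
  by (auto simp: vertex_point_def edge_point_def algebra_simps)

lemma edge_point_0: "edge_point u v 0 = vertex_point u"
  by (auto simp: vertex_point_def edge_point_def)

lemma edge_point_1: "edge_point u v 1 = vertex_point v"
  by (auto simp: vertex_point_def edge_point_def)

lemma edge_point_commute: "edge_point u v t = edge_point v u (1 - t)"
  by (auto simp: edge_point_def algebra_simps)

lemma cut_fun_vertex_point: "cut_fun X P (vertex_point v) = indicator P v"
  by (simp add: vertex_point_eq_edge_point[of v 0] cut_fun_edge_point)

lemma cut_fun_End: "cut_fun X P (End \<omega>) = of_bool (\<omega> \<in> ends_in X P)"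
  by (simp add: cut_fun_def)

lemma graph_points_cases:
  assumes "z \<in> graph_points X"
  obtains v where "v \<in> verts X" "z = vertex_point v"
  | u v t where "adj X u v" "u \<noteq> v" "0 < t" "t < 1" "z = edge_point u v t"
proof -
  from assms consider v where "v \<in> verts X" "z = vertex_point v"
    | u v t where "u \<in> verts X" "v \<in> verts X" "adj X u v" "0 \<le> t" "t \<le> 1" "z = edge_point u v t"
    by (auto simp: graph_points_def)
  then show thesis
  proof cases
    case 2
    consider "u = v" | "t = 0" | "t = 1" | "u \<noteq> v" "0 < t" "t < 1"
      using 2 by fastforce
    then show thesis
      by cases (use 2 that in \<open>auto simp: edge_point_0 edge_point_1 simp flip: vertex_point_eq_edge_point\<close>)
  qed (use that in blast)
qed

context locally_finite_graph
begin

lemma edge_point_in_graph_points: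
  "adj X u v \<Longrightarrow> 0 \<le> t \<Longrightarrow> t \<le> 1 \<Longrightarrow> edge_point u v t \<in> graph_points X"
  using adj_verts adj_verts2 by (auto simp: graph_points_def)

lemma topspace_cases:
  assumes "z \<in> topspace (freudenthal X)"
  obtains v where "v \<in> verts X" "z = vertex_point v"
  | u v t where "adj X u v" "u \<noteq> v" "0 < t" "t < 1" "z = edge_point u v t"
  | \<omega> where "\<omega> \<in> ends X" "z = End \<omega>"
proof -
  from assms consider "z \<in> graph_points X" | \<omega> where "\<omega> \<in> ends X" "z = End \<omega>"
    by (auto simp: topspace_freudenthal[OF symp_adj])
  then show thesis
    by cases (use that in \<open>auto elim: graph_points_cases\<close>)
qed

text \<open>A ray is injective, so it cannot eventually be constant.\<close>

lemma cut_fun_vertex_End: "\<omega> \<in> ends X \<Longrightarrow> cut_fun X {w} (End \<omega>) = 0"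
proof -
  assume \<omega>: "\<omega> \<in> ends X"
  then obtain r where r: "r \<in> \<omega>" "ray X r"
    using ends_nonempty by blast
  have False if "\<forall>\<^sub>F i in sequentially. r i = w"
  proof -
    obtain N where "r N = w" "r (Suc N) = w"
      using \<open>\<forall>\<^sub>F i in sequentially. r i = w\<close> unfolding eventually_sequentially by (meson le_SucI order_refl)
    then show False
      using r by (metis ray_def inj_eq n_not_Suc_n)
  qed
  then show ?thesis
    using r by (auto simp: cut_fun_End ends_in_def)
qed

lemma graph_open_cut_fun:
  assumes "open O1"
  shows "graph_open X {z \<in> graph_points X. cut_fun X P z \<in> O1}"
  unfolding graph_open_def
proof (intro conjI ballI impI)
  fix u v assume uv: "u \<in> verts X" "v \<in> verts X" "adj X u v"
  have "openin (top_of_set {0..1})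
      ({0..1} \<inter> (\<lambda>t. (1 - t) * indicator P u + t * indicator P v) -` O1)"
    using assms by (intro continuous_openin_preimage_gen continuous_intros)
  moreover have "{0..1} \<inter> (\<lambda>t. (1 - t) * indicator P u + t * indicator P v) -` O1
    = {t \<in> {0..1}. edge_point u v t \<in> {z \<in> graph_points X. cut_fun X P z \<in> O1}}"
    using uv edge_point_in_graph_points by (auto simp: cut_fun_edge_point)
  ultimately show "openin (top_of_set {0..1})
      {t \<in> {0..1}. edge_point u v t \<in> {z \<in> graph_points X. cut_fun X P z \<in> O1}}"
    by simp
qed auto

text \<open>The neighbourhood also contains inner points of edges from \<open>C\<close> to
  \<open>S\<close>. They cause no jump: a vertex of \<open>C\<close> is outside the boundary of
  \<open>P\<close>, so all its neighbours, even those in \<open>S\<close>, lie on its side.\<close>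

lemma cut_fun_end_nbhd:
  assumes C: "C \<in> comps X S" and S: "boundary X P \<subseteq> S" and z: "z \<in> end_nbhd X C"
  shows "cut_fun X P z = of_bool (C \<subseteq> P)"
proof -
  from C obtain w0 where w0: "w0 \<in> C"
    by (auto simp: comps_def same_component_def)
  have side: "w \<in> P \<longleftrightarrow> C \<subseteq> P" if "w \<in> C" for w
    using comps_side[OF C S] that by blast
  have nbr: "v \<in> P \<longleftrightarrow> C \<subseteq> P" if "w \<in> C" "adj X w v \<or> adj X v w" for w v
  proof -
    have "w \<notin> boundary X P"
      using comps_subset[OF C] that S by blast
    then show ?thesis
      using that side[OF that(1)] by (auto simp: boundary_def)
  qed
  from z consider p where "z = GraphPoint p" "GraphPoint p \<in> graph_points X" "\<exists>w\<in>C. p w \<noteq> 0"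
    | \<omega> where "z = End \<omega>" "\<omega> \<in> ends_in X C"
    by (auto simp: end_nbhd_def)
  then show ?thesis
  proof cases
    case 1
    obtain w where w: "w \<in> C" "p w \<noteq> 0" using 1 by blast
    from 1(2) show ?thesis
    proof (cases rule: graph_points_cases)
      case (1 v)
      then have "w = v"
        using w(2) by (auto simp: vertex_point_def indicator_def split: if_splits)
      then show ?thesis
        using 1 w \<open>z = GraphPoint p\<close> side by (simp add: cut_fun_vertex_point indicator_def)
    next
      case (2 u v t)
      then have "w = u \<or> w = v"
        using w(2) by (auto simp: edge_point_def indicator_def split: if_splits)
      then have "(u \<in> P \<longleftrightarrow> C \<subseteq> P) \<and> (v \<in> P \<longleftrightarrow> C \<subseteq> P)"
        using nbr[OF w(1)] side[OF w(1)] 2 by blast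
      then show ?thesis
        using 2 \<open>z = GraphPoint p\<close> by (simp add: cut_fun_edge_point indicator_def)
    qed
  next
    case 2
    then obtain r where r: "r \<in> \<omega>"
      using ends_nonempty by (auto simp: ends_in_def)
    show ?thesis
    proof (cases "C \<subseteq> P")
      case True
      then show ?thesis
        using 2 by (auto simp: cut_fun_End ends_in_def elim!: eventually_mono)
    next
      case False
      then have "C \<inter> P = {}" using comps_side[OF C S] by blast
      moreover have "\<exists>i. r i \<in> C \<and> r i \<in> P" if "\<omega> \<in> ends_in X P"
        using eventually_conj[of "\<lambda>i. r i \<in> C" sequentially "\<lambda>i. r i \<in> P"] 2 that r
        by (auto simp: ends_in_def eventually_sequentially)
      ultimately show ?thesis
        using 2 False by (auto simp: cut_fun_End)
    qed
  qed
qed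

text \<open>On the 1-complex the function is affine on each edge. Near an end it is locally
  constant, as seen by deleting the finite boundary of \<open>P\<close>.\<close>

lemma continuous_map_cut_fun:
  assumes "finite (boundary X P)"
  shows "continuous_map (freudenthal X) euclideanreal (cut_fun X P)"
  unfolding continuous_map_def
proof (intro conjI allI impI)
  fix O1 :: "real set" assume "openin euclideanreal O1"
  then have O1: "open O1" by simp
  let ?U = "{z \<in> topspace (freudenthal X). cut_fun X P z \<in> O1}"
  show "openin (freudenthal X) ?U"
  proof (subst openin_subopen, intro ballI)
    fix z assume z: "z \<in> ?U"
    show "\<exists>T. openin (freudenthal X) T \<and> z \<in> T \<and> T \<subseteq> ?U"
    proof (cases "z \<in> graph_points X")
      case True
      have "openin (freudenthal X) {z \<in> graph_points X. cut_fun X P z \<in> O1}"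
        unfolding freudenthal_def using graph_open_cut_fun[OF O1]
        by (intro topology_generated_by_Basis) auto
      then show ?thesis
        using True z by (intro exI[of _ "{z \<in> graph_points X. cut_fun X P z \<in> O1}"])
          (auto simp: topspace_freudenthal[OF symp_adj])
    next
      case False
      then obtain \<omega> where \<omega>: "\<omega> \<in> ends X" "z = End \<omega>"
        using z by (auto simp: topspace_freudenthal[OF symp_adj])
      obtain C where C: "C \<in> comps X (boundary X P)" "\<omega> \<in> ends_in X C"
        using ends_in_comps[OF \<omega>(1) assms boundary_subset_verts] by blast
      have "openin (freudenthal X) (end_nbhd X C)"
        unfolding freudenthal_def using C assms boundary_subset_verts
        by (intro topology_generated_by_Basis) auto
      moreover have "z \<in> end_nbhd X C"
        using C \<omega> by (simp add: end_nbhd_def)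
      moreover have "end_nbhd X C \<subseteq> ?U"
        using cut_fun_end_nbhd[OF C(1) order_refl] z \<open>z \<in> end_nbhd X C\<close>
          openin_subset[OF \<open>openin (freudenthal X) (end_nbhd X C)\<close>] by auto
      ultimately show ?thesis by blast
    qed
  qed
qed auto

end


section \<open>Closed curves through all vertices\<close>

context locally_finite_graph
begin

lemma vertex_point_inject [simp]: "vertex_point v = vertex_point w \<longleftrightarrow> v = w"
  by (auto simp: vertex_point_def fun_eq_iff indicator_def split: if_splits)

text \<open>Vertices and ends have values 0 or 1, so the level 1/2 consists of midpoints of cut
  edges. Crossing a cut can thus be detected by attaining this value.\<close>

lemma cut_fun_eq_half:
  assumes "z \<in> topspace (freudenthal X)" "cut_fun X P z = 1/2"
  obtains u v where "adj X u v" "u \<in> P" "v \<notin> P" "z = edge_point u v (1/2)"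
  using assms(1)
proof (cases rule: topspace_cases)
  case (2 u v t)
  have "cut_fun X P z = (1 - t) * indicator P u + t * indicator P v"
    using 2 by (simp add: cut_fun_edge_point)
  then have t: "t = 1/2" and "(u \<in> P) \<noteq> (v \<in> P)"
    using assms(2) by (cases "u \<in> P"; cases "v \<in> P"; auto)+
  moreover have "z = edge_point u v (1/2)" "z = edge_point v u (1/2)"
    using 2(5) edge_point_commute[of u v "1/2"] by (simp_all add: t)
  ultimately show thesis
    using that[of u v] that[of v u] adj_sym 2(1) by blast
qed (use assms(2) in \<open>auto simp: cut_fun_vertex_point cut_fun_End indicator_def of_bool_def split: if_splits\<close>)

lemma cut_fun_vertex_nonneg:
  assumes "z \<in> topspace (freudenthal X)"
  shows "0 \<le> cut_fun X {w} z"
  using assms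
  by (cases rule: topspace_cases;
      auto simp: cut_fun_vertex_point cut_fun_vertex_End cut_fun_edge_point indicator_def)+

text \<open>The two coordinates exhaust the total mass 1, so nothing is left for other vertices; an
  end is excluded because all its vertex coordinates vanish.\<close>

lemma eq_edge_point:
  assumes "z \<in> topspace (freudenthal X)" "v \<noteq> w" "cut_fun X {v} z + cut_fun X {w} z = 1"
  shows "z = edge_point v w (cut_fun X {w} z)"
  using assms(1)
proof (cases rule: topspace_cases)
  case (1 u)
  then show ?thesis
    using assms(2,3)
    by (auto simp: cut_fun_vertex_point edge_point_0 edge_point_1 indicator_def of_bool_def
        split: if_splits)
next
  case (2 a b t)
  then have "(a = v \<and> b = w) \<or> (a = w \<and> b = v)"
    using assms(2,3) by (auto simp: cut_fun_edge_point indicator_def of_bool_def split: if_splits)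
  then show ?thesis
    using 2 assms(2) edge_point_commute[of a b t] by (auto simp: cut_fun_edge_point)
next
  case (3 \<omega>)
  then show ?thesis
    using assms by (simp add: cut_fun_vertex_End)
qed

text \<open>Two positive coordinates occur only inside the edge between \<open>v\<close> and
  \<open>w\<close>. With \<open>eq_edge_point\<close>, positivity of both thus describes that open
  edge by continuous functions.\<close>

lemma cut_fun_vertex_add:
  assumes "z \<in> topspace (freudenthal X)" "v \<noteq> w" "0 < cut_fun X {v} z" "0 < cut_fun X {w} z"
  shows "cut_fun X {v} z + cut_fun X {w} z = 1"
  using assms(1)
  by (cases rule: topspace_cases)
    (use assms in \<open>auto simp: cut_fun_vertex_point cut_fun_vertex_End cut_fun_edge_point
      indicator_def of_bool_def split: if_splits\<close>)

lemma edge_point_eq_imp: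
  fixes v w w' :: 'v
  assumes "edge_point v w t = edge_point v w' t'" "0 < t'" "w' \<noteq> v"
  shows "w = w'"
proof (rule ccontr)
  assume "w \<noteq> w'"
  then have "cut_fun X {w'} (edge_point v w t) = 0" "cut_fun X {w'} (edge_point v w' t') = t'"
    using assms(3) by (simp_all add: cut_fun_edge_point)
  then show False
    using assms by simp
qed

end

text \<open>The circle is unrolled to a 1-periodic map on the reals, so that any parameter can serve
  as the start of a period and intervals replace arcs. Continuity is recorded only after composition
  with cut functions, the sole form in which it is needed.\<close>

locale vertex_curve = locally_finite_graph X for X :: "'v graph" +
  fixes \<gamma> :: "real \<Rightarrow> 'v fpoint"
  assumes \<gamma>_in_topspace: "\<gamma> x \<in> topspace (freudenthal X)"
    and vertex_in_range: "v \<in> verts X \<Longrightarrow> vertex_point v \<in> range \<gamma>"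
    and \<gamma>_periodic: "\<gamma> (x + 1) = \<gamma> x"
    and \<gamma>_inj: "\<gamma> x = \<gamma> y \<Longrightarrow> \<bar>x - y\<bar> < 1 \<Longrightarrow> x = y"
    and continuous_cut_fun: "finite (boundary X P) \<Longrightarrow> continuous_on UNIV (\<lambda>x. cut_fun X P (\<gamma> x))"
begin

text \<open>The midpoint stands for the whole edge: \<open>edge_arc\<close> shows that a curve
  containing one inner point of an edge contains all of it.\<close>

definition used :: "'v \<Rightarrow> 'v \<Rightarrow> bool" where
  "used u v \<longleftrightarrow> adj X u v \<and> edge_point u v (1/2) \<in> range \<gamma>"

lemma used_sym: "used u v \<Longrightarrow> used v u"
  using adj_sym edge_point_commute[of u v "1/2"] by (auto simp: used_def)

lemma \<gamma>_add_int: "\<gamma> (x + of_int k) = \<gamma> x"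
proof (induction k arbitrary: x rule: int_induct[of _ 0])
  case (step1 i)
  then show ?case
    using \<gamma>_periodic[of "x + of_int i"] by (simp add: add.assoc)
next
  case (step2 i)
  then show ?case
    using \<gamma>_periodic[of "x + of_int (i - 1)"] by simp
qed simp

lemma range_period:
  assumes "z \<in> range \<gamma>"
  obtains x where "a \<le> x" "x < a + 1" "\<gamma> x = z"
proof -
  obtain y where y: "z = \<gamma> y" using assms by blast
  have "\<gamma> (a + frac (y - a)) = \<gamma> (y + of_int (- \<lfloor>y - a\<rfloor>))"
    by (simp add: frac_def)
  then have "\<gamma> (a + frac (y - a)) = z"
    using \<gamma>_add_int[of y "- \<lfloor>y - a\<rfloor>"] y by simp
  then show thesis
    using that[of "a + frac (y - a)"] frac_ge_0[of "y - a"] frac_lt_1[of "y - a"] by simp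
qed

text \<open>Removing one point from a circle leaves it connected, so a cut is met in at least two edges.\<close>

lemma two_used_edges:
  assumes fin: "finite (boundary X P)" and p: "p \<in> verts X" "p \<in> P" and q: "q \<in> verts X" "q \<notin> P"
    and one: "\<And>u v. used u v \<Longrightarrow> u \<in> P \<Longrightarrow> v \<notin> P \<Longrightarrow> (u, v) = e"
  shows False
proof -
  define f where "f x = cut_fun X P (\<gamma> x)" for x
  have f_half: "\<gamma> x = edge_point (fst e) (snd e) (1/2)" if "f x = 1/2" for x
    using cut_fun_eq_half[OF \<gamma>_in_topspace, of P x] one that
    unfolding f_def used_def by (metis fst_conv snd_conv rangeI)
  \<comment> \<open>\<open>\<theta>\<close> is the point removed from the circle, a parameter of the
    midpoint of \<open>e\<close>. If the level 1/2 is never attained, any \<open>\<theta>\<close>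
    will do.\<close>
  obtain \<theta> where \<theta>: "\<And>x. f x = 1/2 \<Longrightarrow> \<gamma> x = \<gamma> \<theta>"
  proof (cases "\<exists>x. f x = 1/2")
    case True
    then obtain x where "f x = 1/2" by blast
    then show thesis using that[of x] f_half by metis
  qed (use that in blast)
  obtain x where x: "\<theta> \<le> x" "x < \<theta> + 1" "\<gamma> x = vertex_point p"
    using range_period[OF vertex_in_range[OF p(1)]] by blast
  obtain y where y: "\<theta> \<le> y" "y < \<theta> + 1" "\<gamma> y = vertex_point q"
    using range_period[OF vertex_in_range[OF q(1)]] by blast
  have fxy: "f x = 1" "f y = 0"
    using x y p q by (simp_all add: f_def cut_fun_vertex_point)
  have cont: "continuous_on S f" for S
    using continuous_cut_fun[OF fin] unfolding f_def by (rule continuous_on_subset) simp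
  \<comment> \<open>\<open>z\<close> lies between \<open>x\<close> and \<open>y\<close> and differs
    from both because of the values of \<open>f\<close>, hence it is strictly to the right of
    \<open>\<theta>\<close>.\<close>
  obtain z where z: "\<theta> \<le> z" "z < \<theta> + 1" "z \<noteq> \<theta>" "f z = 1/2"
  proof (cases "x \<le> y")
    case True
    then obtain z where "x \<le> z" "z \<le> y" "f z = 1/2"
      using IVT2'[of f y "1/2" x] fxy cont by auto
    then show thesis
      using that[of z] x y fxy by (cases "z = x") auto
  next
    case False
    then obtain z where "y \<le> z" "z \<le> x" "f z = 1/2"
      using IVT'[of f y "1/2" x] fxy cont by auto
    then show thesis
      using that[of z] x y fxy by (cases "z = y") auto
  qed
  then show False
    using \<gamma>_inj[OF \<theta>[OF z(4)]] by simp
qed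

text \<open>The period is cut at \<open>v\<close>. The maximal parameter interval on which the curve
  stays inside the open edge must lead from one end of the edge to the other, and its end at
  \<open>v\<close> can only be \<open>\<theta>\<close> or \<open>\<theta> + 1\<close>. That
  alternative yields the degree bound, the traversal of the whole edge yields the rest.\<close>

lemma edge_arc:
  assumes vw: "v \<noteq> w" "w \<in> verts X" and \<theta>: "\<gamma> \<theta> = vertex_point v"
    and t: "0 < t" "t < 1" "edge_point v w t \<in> range \<gamma>"
  obtains l r where "\<theta> \<le> l" "l < r" "r \<le> \<theta> + 1" "l = \<theta> \<or> r = \<theta> + 1"
    "\<And>x. l < x \<Longrightarrow> x < r \<Longrightarrow> \<exists>t. 0 < t \<and> t < 1 \<and> \<gamma> x = edge_point v w t"
    "\<And>t. 0 \<le> t \<Longrightarrow> t \<le> 1 \<Longrightarrow> edge_point v w t \<in> range \<gamma>"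
proof -
  define a where "a x = cut_fun X {v} (\<gamma> x)" for x
  define b where "b x = cut_fun X {w} (\<gamma> x)" for x
  have cont_a: "continuous_on S a" and cont_b: "continuous_on S b" for S
    using continuous_cut_fun[OF finite_boundary_vertex] unfolding a_def b_def
    by (meson continuous_on_subset subset_UNIV)+
  have bounds: "0 \<le> a x" "0 \<le> b x" for x
    unfolding a_def b_def by (rule cut_fun_vertex_nonneg[OF \<gamma>_in_topspace])+
  obtain \<theta>1 where \<theta>1: "\<theta> \<le> \<theta>1" "\<theta>1 < \<theta> + 1" "\<gamma> \<theta>1 = edge_point v w t"
    using range_period[OF t(3)] by blast
  have ab_\<theta>1: "a \<theta>1 * b \<theta>1 > 0"
    using \<theta>1 t vw by (simp add: a_def b_def cut_fun_edge_point)
  \<comment> \<open>Parameters at which the curve is not inside the open edge; \<open>l\<close> and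
    \<open>r\<close> will be the nearest ones on either side of \<open>\<theta>1\<close>.\<close>
  define K where "K = {x \<in> {\<theta>..\<theta> + 1}. a x * b x \<le> 0}"
  have "K = {\<theta>..\<theta> + 1} \<inter> {x. a x * b x \<le> 0}"
    by (auto simp: K_def)
  moreover have "closed {x. a x * b x \<le> 0}"
    by (intro closed_Collect_le continuous_intros cont_a cont_b)
  ultimately have "compact K"
    by (simp add: compact_Int_closed)
  then have "compact (K \<inter> {..\<theta>1})" "compact (K \<inter> {\<theta>1..})"
    by (simp_all add: compact_Int_closed)
  have end_in_K: "\<theta> \<in> K" "\<theta> + 1 \<in> K"
    using \<theta> vw \<gamma>_periodic[of \<theta>] by (simp_all add: K_def a_def b_def cut_fun_vertex_point)
  obtain l where l: "l \<in> K" "l \<le> \<theta>1" "\<And>x. x \<in> K \<Longrightarrow> x \<le> \<theta>1 \<Longrightarrow> x \<le> l"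
    using compact_attains_sup[OF \<open>compact (K \<inter> {..\<theta>1})\<close>] end_in_K \<theta>1 by fastforce
  obtain r where r: "r \<in> K" "\<theta>1 \<le> r" "\<And>x. x \<in> K \<Longrightarrow> \<theta>1 \<le> x \<Longrightarrow> r \<le> x"
    using compact_attains_inf[OF \<open>compact (K \<inter> {\<theta>1..})\<close>] end_in_K \<theta>1 by fastforce
  have "\<theta>1 \<notin> K" using ab_\<theta>1 by (simp add: K_def)
  then have lr: "l < \<theta>1" "\<theta>1 < r" "\<theta> \<le> l" "r \<le> \<theta> + 1"
    using l r by (auto simp: K_def less_le)
  have inner: "a x > 0 \<and> b x > 0" if "l < x" "x < r" for x
  proof -
    have "x \<notin> K" using l(3)[of x] r(3)[of x] that by linarith
    then have "a x * b x > 0" using that lr by (auto simp: K_def)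
    then show ?thesis using bounds[of x] by (auto simp: zero_less_mult_iff)
  qed
  have "a x + b x = 1" if "x \<in> {l<..<r}" for x
    using cut_fun_vertex_add[OF \<gamma>_in_topspace vw(1)] inner that unfolding a_def b_def by auto
  \<comment> \<open>Continuity carries the identity to \<open>l\<close> and \<open>r\<close>, where
    the product of \<open>a\<close> and \<open>b\<close> vanishes and so \<open>b\<close> is 0 or
    1.\<close>
  then have sum: "a x + b x = 1" if "x \<in> {l..r}" for x
    using continuous_constant_on_closure[of "{l<..<r}" "\<lambda>x. a x + b x" 1 x] that lr
      continuous_on_add[OF cont_a cont_b] by simp
  have on_edge: "\<gamma> x = edge_point v w (b x)" if "x \<in> {l..r}" for x
    using eq_edge_point[OF \<gamma>_in_topspace vw(1)] sum[OF that] unfolding a_def b_def by simp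
  have ends: "x \<in> K \<Longrightarrow> x \<in> {l..r} \<Longrightarrow> b x = 0 \<or> b x = 1" for x
    using sum[of x] bounds[of x] unfolding K_def by (auto simp: mult_le_0_iff)
  have at_v: "x = \<theta> \<or> x = \<theta> + 1" if "x \<in> {l..r}" "b x = 0" for x
    using on_edge[OF that(1)] that \<theta> \<gamma>_inj[of x \<theta>] lr by (auto simp: edge_point_0)
  \<comment> \<open>If both ends are at \<open>v\<close>, the arc is the whole period and
    \<open>w\<close> is never visited. If both are at \<open>w\<close>, then \<open>w\<close> is
    visited twice within less than a period.\<close>
  have False if "b l = b r"
  proof (cases "b l = 0")
    case True
    have "l = \<theta>" "r = \<theta> + 1"
      using at_v[of l] at_v[of r] True that lr by auto
    obtain x where x: "\<theta> \<le> x" "x < \<theta> + 1" "\<gamma> x = vertex_point w"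
      using range_period[OF vertex_in_range[OF vw(2)]] by blast
    moreover have "x \<noteq> \<theta>"
      using x \<theta> vw by auto
    ultimately have "0 < a x"
      using inner[of x] \<open>l = \<theta>\<close> \<open>r = \<theta> + 1\<close> by simp
    then show False
      using x vw by (simp add: a_def cut_fun_vertex_point)
  next
    case False
    then have "b l = 1" "b r = 1" using ends[OF l(1)] that lr by auto
    then have "\<gamma> l = \<gamma> r" using on_edge[of l] on_edge[of r] lr by simp
    moreover have "r - l < 1"
    proof (rule ccontr)
      assume "\<not> r - l < 1"
      then have "l = \<theta>" using lr by simp
      then show False using \<theta> \<open>b l = 1\<close> vw by (simp add: b_def cut_fun_vertex_point)
    qed
    ultimately show False using \<gamma>_inj[of l r] lr by simp
  qed
  then have b_ends: "(b l = 0 \<and> b r = 1) \<or> (b l = 1 \<and> b r = 0)"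
    using ends[OF l(1)] ends[OF r(1)] lr by fastforce
  show thesis
  proof (rule that[of l r])
    show "l = \<theta> \<or> r = \<theta> + 1"
      using at_v[of l] at_v[of r] b_ends lr by auto
    show "\<exists>t. 0 < t \<and> t < 1 \<and> \<gamma> x = edge_point v w t" if "l < x" "x < r" for x
      using inner[OF that] sum[of x] on_edge[of x] that
      by (intro exI[of _ "b x"]) auto
    show "edge_point v w t \<in> range \<gamma>" if "0 \<le> t" "t \<le> 1" for t
    proof -
      from b_ends have "\<exists>x\<ge>l. x \<le> r \<and> b x = t"
      proof
        assume "b l = 0 \<and> b r = 1"
        then show ?thesis using IVT'[of b l t r] cont_b that lr by simp
      next
        assume "b l = 1 \<and> b r = 0"
        then show ?thesis using IVT2'[of b r t l] cont_b that lr by simp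
      qed
      then obtain x where "x \<in> {l..r}" "b x = t" by auto
      then show ?thesis using on_edge[of x] by (metis rangeI)
    qed
  qed (use lr in auto)
qed

lemma used_edge_subset:
  assumes "used v w" "v \<noteq> w" "0 \<le> t" "t \<le> 1"
  shows "edge_point v w t \<in> range \<gamma>"
proof -
  obtain \<theta> where "\<gamma> \<theta> = vertex_point v"
    using vertex_in_range adj_verts assms by (metis used_def rangeE)
  then show ?thesis
    using edge_arc[of v w \<theta> "1/2"] assms adj_verts2 by (auto simp: used_def)
qed

lemma usedI:
  assumes "adj X v w" "v \<noteq> w" "0 < t" "t < 1" "edge_point v w t \<in> range \<gamma>"
  shows "used v w"
proof -
  obtain \<theta> where \<theta>: "\<gamma> \<theta> = vertex_point v"
    using vertex_in_range adj_verts assms by (metis rangeE)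
  have "edge_point v w (1/2) \<in> range \<gamma>"
    by (rule edge_arc[OF assms(2) adj_verts2[OF assms(1)] \<theta> assms(3-5)]) auto
  then show ?thesis using assms by (simp add: used_def)
qed

text \<open>Each used edge at \<open>v\<close> occupies an interval directly after
  \<open>\<theta>\<close> or directly before \<open>\<theta> + 1\<close>. Two of three edges share a
  side, but distinct open edges at \<open>v\<close> are disjoint.\<close>

lemma used_degree_le_2:
  assumes "used v w1" "used v w2" "used v w3" "v \<notin> {w1, w2, w3}"
    "w1 \<noteq> w2" "w1 \<noteq> w3" "w2 \<noteq> w3"
  shows False
proof -
  obtain \<theta> where \<theta>: "\<gamma> \<theta> = vertex_point v"
    using vertex_in_range adj_verts assms by (metis used_def rangeE)
  define inner where "inner w x \<longleftrightarrow> (\<exists>t. 0 < t \<and> t < 1 \<and> \<gamma> x = edge_point v w t)" for w x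
  have arc: "(\<exists>r>\<theta>. \<forall>x. \<theta> < x \<and> x < r \<longrightarrow> inner w x)
      \<or> (\<exists>l<\<theta> + 1. \<forall>x. l < x \<and> x < \<theta> + 1 \<longrightarrow> inner w x)" if "used v w" "v \<noteq> w" for w
  proof -
    have "w \<in> verts X" "edge_point v w (1/2) \<in> range \<gamma>"
      using that adj_verts2 by (auto simp: used_def)
    show ?thesis
    proof (rule edge_arc[OF \<open>v \<noteq> w\<close> \<open>w \<in> verts X\<close> \<theta> _ _ \<open>edge_point v w (1/2) \<in> range \<gamma>\<close>])
      fix l r
      assume "\<theta> \<le> l" "l < r" "r \<le> \<theta> + 1" "l = \<theta> \<or> r = \<theta> + 1"
        and "\<And>x. l < x \<Longrightarrow> x < r \<Longrightarrow> \<exists>t. 0 < t \<and> t < 1 \<and> \<gamma> x = edge_point v w t"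
      then show ?thesis
        unfolding inner_def by auto
    qed simp_all
  qed
  have unique: "w = w'" if "inner w x" "inner w' x" "w' \<noteq> v" for w w' x
    using that edge_point_eq_imp unfolding inner_def by metis
  have right: "w = w'" if "r > \<theta>" "\<forall>x. \<theta> < x \<and> x < r \<longrightarrow> inner w x"
    "r' > \<theta>" "\<forall>x. \<theta> < x \<and> x < r' \<longrightarrow> inner w' x" "w' \<noteq> v" for w w' r r'
  proof -
    have "\<theta> < min r r'" using that by simp
    then obtain x where "\<theta> < x" "x < min r r'"
      using dense by blast
    then show ?thesis using unique[of w x w'] that by auto
  qed
  have left: "w = w'" if "l < \<theta> + 1" "\<forall>x. l < x \<and> x < \<theta> + 1 \<longrightarrow> inner w x"
    "l' < \<theta> + 1" "\<forall>x. l' < x \<and> x < \<theta> + 1 \<longrightarrow> inner w' x" "w' \<noteq> v" for w w' l l'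
  proof -
    have "max l l' < \<theta> + 1" using that by simp
    then obtain x where "max l l' < x" "x < \<theta> + 1"
      using dense by blast
    then show ?thesis using unique[of w x w'] that by auto
  qed
  define R where "R w \<longleftrightarrow> (\<exists>r>\<theta>. \<forall>x. \<theta> < x \<and> x < r \<longrightarrow> inner w x)" for w
  define L where "L w \<longleftrightarrow> (\<exists>l<\<theta> + 1. \<forall>x. l < x \<and> x < \<theta> + 1 \<longrightarrow> inner w x)" for w
  have "R w1 \<or> L w1" "R w2 \<or> L w2" "R w3 \<or> L w3"
    unfolding R_def L_def using arc assms by auto
  moreover have "w = w'" if "R w" "R w'" "w' \<noteq> v" for w w'
    using that right unfolding R_def by blast
  moreover have "w = w'" if "L w" "L w'" "w' \<noteq> v" for w w'
    using that left unfolding L_def by blast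
  ultimately show False
    using assms(4-) by blast
qed

text \<open>Parameters of the vertices of a ray in \<open>\<omega>\<close> accumulate at some
  \<open>l\<close> by compactness. The coordinates at single vertices vanish at \<open>l\<close>, so
  \<open>\<gamma> l\<close> is an end; cut functions of components identify it as
  \<open>\<omega>\<close>.\<close>

lemma ends_in_range:
  assumes "\<omega> \<in> ends X"
  shows "End \<omega> \<in> range \<gamma>"
proof -
  obtain r where r: "r \<in> \<omega>" "ray X r"
    using ends_nonempty[OF assms] by blast
  have "\<exists>x. x \<in> {0..1} \<and> \<gamma> x = vertex_point (r i)" for i
    using range_period[OF vertex_in_range, of "r i" 0] r(2)
    by (metis add_0 atLeastAtMost_iff less_le_not_le ray_def range_subsetD)
  then obtain x where x: "\<And>i. x i \<in> {0..1}" "\<And>i. \<gamma> (x i) = vertex_point (r i)"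
    by metis
  obtain l k where k: "strict_mono k" "(x \<circ> k) \<longlonglongrightarrow> l"
    using compact_Icc[of "0::real" 1] x(1) unfolding compact_def by metis
  have lim: "(\<lambda>i. cut_fun X P (\<gamma> ((x \<circ> k) i))) \<longlonglongrightarrow> cut_fun X P (\<gamma> l)"
    if "finite (boundary X P)" for P
    by (rule continuous_on_tendsto_compose[OF continuous_cut_fun[OF that] k(2)]) auto
  have lim_eventually: "cut_fun X P (\<gamma> l) = of_bool b"
    if "finite (boundary X P)" "\<forall>\<^sub>F i in sequentially. (r i \<in> P) = b" for P b
  proof -
    have "\<forall>\<^sub>F i in sequentially. cut_fun X P (\<gamma> ((x \<circ> k) i)) = of_bool b"
      using eventually_subseq[OF k(1) that(2)] by eventually_elim (auto simp: x cut_fun_vertex_point)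
    from tendsto_eventually[OF this] show ?thesis
      using lim[OF that(1)] LIMSEQ_unique by blast
  qed
  have zero: "cut_fun X {w} (\<gamma> l) = 0" for w
  proof -
    obtain C where C: "C \<in> comps X {w}" "\<forall>\<^sub>F i in sequentially. r i \<in> C"
      using ray_comps[OF r(2), of "{w}"] by auto
    have "\<forall>\<^sub>F i in sequentially. (r i \<in> {w}) = False"
      using C(2) by eventually_elim (use comps_subset[OF C(1)] in auto)
    from lim_eventually[OF finite_boundary_vertex this] show ?thesis by simp
  qed
  from \<gamma>_in_topspace[of l] obtain \<omega>' where \<omega>': "\<omega>' \<in> ends X" "\<gamma> l = End \<omega>'"
  proof (cases rule: topspace_cases)
    case (1 v)
    then show ?thesis using zero[of v] by (simp add: cut_fun_vertex_point)
  next
    case (2 u v t)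
    then show ?thesis using zero[of v] by (simp add: cut_fun_edge_point)
  qed (use that in blast)
  have "\<omega> = \<omega>'"
  proof (rule ends_eqI[OF assms \<omega>'(1)])
    fix S C assume "finite S" "C \<in> comps X S" "\<omega> \<in> ends_in X C"
    then have "cut_fun X C (\<gamma> l) = of_bool True"
      using r(1) by (intro lim_eventually finite_boundary_comps) (auto simp: ends_in_def)
    then show "\<omega>' \<in> ends_in X C"
      by (simp add: \<omega>' cut_fun_End split: if_splits)
  qed
  then show ?thesis using \<omega>' by (metis rangeI)
qed

end

section \<open>Hamiltonian circles as periodic curves\<close>

context locally_finite_graph
begin

text \<open>The homeomorphism from the unit circle is composed with the covering
  \<open>x \<mapsto> cis (2 * pi * x)\<close> of the circle by the line.\<close>

lemma hamiltonian_circle_curve: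
  assumes "hamiltonian_circle X C"
  obtains \<gamma> where "vertex_curve X \<gamma>" "range \<gamma> = C"
proof -
  have C: "C \<subseteq> topspace (freudenthal X)" "vertex_point ` verts X \<subseteq> C"
    and "top_of_set (sphere (0::complex) 1) homeomorphic_space subtopology (freudenthal X) C"
    using assms homeomorphic_space_sym by (auto simp: hamiltonian_circle_def)
  then obtain h where "homeomorphic_map (top_of_set (sphere (0::complex) 1)) (subtopology (freudenthal X) C) h"
    by (auto simp: homeomorphic_space)
  then have cont: "continuous_map (top_of_set (sphere 0 1)) (freudenthal X) h"
    and inj: "inj_on h (sphere 0 1)" and img: "h ` sphere 0 1 = C"
    using C(1) by (auto simp: homeomorphic_eq_everything_map continuous_map_in_subtopology)
  define c where "c x = cis (2 * pi * x)" for x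
  have c_sphere: "c x \<in> sphere 0 1" for x
    by (simp add: c_def)
  have c_range: "range c = sphere 0 1"
  proof -
    have "z \<in> range c" if "cmod z = 1" for z
    proof -
      have "z \<noteq> 0" using that by auto
      then have "z = c (Arg z / (2 * pi))"
        using cis_Arg[of z] that by (simp add: c_def sgn_eq)
      then show ?thesis by blast
    qed
    then show ?thesis using c_sphere by auto
  qed
  have "vertex_curve X (h \<circ> c)"
  proof
    show "(h \<circ> c) x \<in> topspace (freudenthal X)" for x
      using C(1) img c_sphere by auto
    show "vertex_point v \<in> range (h \<circ> c)" if "v \<in> verts X" for v
      using C(2) img c_range that by (auto simp flip: image_image image_comp)
    show "(h \<circ> c) (x + 1) = (h \<circ> c) x" for x
      by (simp add: c_def distrib_left flip: cis_mult)
    show "x = y" if "(h \<circ> c) x = (h \<circ> c) y" "\<bar>x - y\<bar> < 1" for x y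
    proof -
      have "c x = c y"
        using inj_onD[OF inj] that c_sphere by simp
      then have "exp (\<i> * of_real (2 * pi * x)) = exp (\<i> * of_real (2 * pi * y))"
        by (simp add: c_def cis_conv_exp)
      then obtain n :: int where "\<i> * of_real (2 * pi * x) = \<i> * of_real (2 * pi * y) + (of_int (2 * n) * pi) * \<i>"
        unfolding exp_eq by blast
      from arg_cong[OF this, of Im] have "2 * pi * x = 2 * pi * (y + n)"
        by (simp add: algebra_simps)
      then have "x = y + n" by simp
      with that(2) have "\<bar>real_of_int n\<bar> < 1" by simp
      then show ?thesis using \<open>x = y + n\<close> by simp
    qed
    show "continuous_on UNIV (\<lambda>x. cut_fun X P ((h \<circ> c) x))" if "finite (boundary X P)" for P
    proof -
      have "continuous_map euclideanreal (top_of_set (sphere 0 1)) c"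
        using c_sphere unfolding c_def
        by (auto simp: continuous_map_in_subtopology intro!: continuous_intros)
      from continuous_map_compose[OF continuous_map_compose[OF this cont] continuous_map_cut_fun[OF that]]
      show ?thesis by (simp add: comp_def)
    qed
  qed
  moreover have "range (h \<circ> c) = C"
    using img c_range by (metis image_comp)
  ultimately show thesis using that by blast
qed

end


section \<open>Cuts in the Cayley graph of a free group\<close>

lemma reduced_append: "reduced (u @ v) \<Longrightarrow> reduced u"
  by (auto simp: reduced_def successively_append_iff)

lemma free_group_mult_append: "reduced (u @ v) \<Longrightarrow> u \<otimes>\<^bsub>free_group A\<^esub> v = u @ v"
  by (simp add: free_group_def free_reduce_reduced)

lemma free_group_one: "\<one>\<^bsub>free_group A\<^esub> = []"
  by (simp add: free_group_def)

lemma free_group_carrier_iff: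
  "w \<in> carrier (free_group A) \<longleftrightarrow> reduced w \<and> fst ` set w \<subseteq> A"
  by (simp add: free_group_def)

lemma free_group_inv:
  assumes "w \<in> carrier (free_group A)"
  shows "inv\<^bsub>free_group A\<^esub> w = map linv (rev w)"
proof (rule group.inv_equality[OF free_group_group])
  show "map linv (rev w) \<otimes>\<^bsub>free_group A\<^esub> w = \<one>\<^bsub>free_group A\<^esub>"
    by (simp add: free_group_def free_reduce_inverse)
  have "fst ` set (map linv (rev w)) = fst ` set w"
    by (simp add: image_image linv_def)
  then show "map linv (rev w) \<in> carrier (free_group A)"
    using assms reduced_inverse[of w] by (simp add: free_group_carrier_iff)
qed fact

text \<open>In odd length the middle letter would be its own inverse, in even length the two middle
  letters would cancel. Applied to \<open>s\<close>, this makes the two neighbours of a vertex along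
  \<open>s\<close>-edges distinct.\<close>

lemma reduced_neq_inverse:
  assumes "reduced w" "w \<noteq> []"
  shows "map linv (rev w) \<noteq> w"
proof
  assume eq: "map linv (rev w) = w"
  define m where "m = length w div 2"
  have m: "m < length w" using assms by (simp add: m_def)
  have nth: "w ! m = linv (w ! (length w - Suc m))"
    using arg_cong[OF eq, of "\<lambda>v. v ! m"] m by (simp add: rev_nth)
  show False
  proof (cases "even (length w)")
    case True
    then have "length w = 2 * m" by (simp add: m_def)
    moreover from this have "m \<noteq> 0"
      using assms(2) by (metis length_0_conv mult_0_right)
    ultimately have "length w - Suc m = m - 1" "0 < m" by simp_all
    then have "w ! Suc (m - 1) = linv (w ! (m - 1))" "Suc (m - 1) < length w"
      using nth m by auto
    then show False
      using assms(1) by (auto simp: reduced_def successively_conv_nth)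
  next
    case False
    then have "length w = 2 * m + 1" unfolding m_def by presburger
    then have "length w - Suc m = m" by simp
    then show False using nth by (metis linv_neq(2))
  qed
qed

lemma free_group_mult_letter:
  assumes "w \<in> carrier (free_group A)"
  shows "w \<otimes>\<^bsub>free_group A\<^esub> [z] = (if w \<noteq> [] \<and> last w = linv z then butlast w else w @ [z])"
proof (cases "w \<noteq> [] \<and> last w = linv z")
  case True
  then have w: "w = butlast w @ [linv z]"
    by (metis append_butlast_last_id)
  then have "reduced (butlast w)"
    using assms reduced_append by (metis free_group_carrier_iff)
  moreover have "w \<otimes>\<^bsub>free_group A\<^esub> [z] = free_reduce (butlast w)"
    by (subst w) (simp add: free_group_def free_reduce_def)
  ultimately show ?thesis
    using True by (simp add: free_reduce_reduced)
next
  case False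
  then have "reduced (w @ [z])"
    using assms
    by (auto simp: free_group_carrier_iff reduced_def successively_append_iff simp flip: linv_linv)
  then show ?thesis
    using False by (auto simp: free_group_mult_append)
qed

text \<open>The branch of the Cayley tree that lies beyond the edge from the identity to
  \<open>x\<close>.\<close>

definition starts :: "'a \<times> bool \<Rightarrow> 'a word \<Rightarrow> bool" where
  "starts x w \<longleftrightarrow> w \<noteq> [] \<and> hd w = x"

lemma starts_simps [simp]: "\<not> starts x []" "starts x (y # w) \<longleftrightarrow> y = x"
  by (simp_all add: starts_def)

text \<open>Right multiplication by a letter alters only the end of a reduced word, so it reaches
  the first letter only in words of length at most 1. In the tree: a single edge leads into the
  branch.\<close>

lemma starts_mult_letter:
  assumes "w \<in> carrier (free_group A)" "starts x w \<noteq> starts x (w \<otimes>\<^bsub>free_group A\<^esub> [z])"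
  shows "(w = [] \<and> z = x) \<or> (w = [x] \<and> z = linv x)"
proof (cases "w \<noteq> [] \<and> last w = linv z")
  case True
  have "starts x w \<noteq> starts x (butlast w)"
    using assms True by (simp add: free_group_mult_letter)
  moreover have "starts x w = starts x (butlast w)" if "butlast w \<noteq> []"
    using that by (cases w) (auto simp: starts_def split: if_splits)
  ultimately have "butlast w = []" "starts x w"
    by (metis starts_def)+
  then have "w = [x]"
    by (cases w) (auto split: if_splits)
  then show ?thesis using True by auto
next
  case False
  then show ?thesis
    using assms by (cases w) (auto simp: free_group_mult_letter)
qed

lemma occ_eq_card: "occ a w = card {i. i < length w \<and> fst (w ! i) = a}"
proof -
  have "occ a w = length (filter (\<lambda>l. fst l = a) w)"
    by (induction w) (auto simp: occ_def prod_eq_iff)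
  then show ?thesis by (simp add: length_filter_conv_card)
qed

section \<open>The Cayley graph and the cuts given by its tree edges\<close>

locale free_word_graph =
  fixes A :: "'a set" and s :: "'a word"
  assumes finite_A: "finite A" and s_in: "s \<in> carrier (free_group A)"
begin

abbreviation F where "F \<equiv> free_group A"

abbreviation X where
  "X \<equiv> cayley F (with_inverses F (gen ` A) \<union> with_inverses F {s})"

sublocale group F
  by (rule free_group_group)

lemma letter_in: "fst x \<in> A \<Longrightarrow> [x] \<in> carrier F"
  by (simp add: free_group_carrier_iff reduced_def)

lemma fst_linv [simp]: "fst (linv x) = fst x"
  by (simp add: linv_def)

lemma letter_mult_linv: "fst x \<in> A \<Longrightarrow> [x] \<otimes>\<^bsub>F\<^esub> [linv x] = []"
  using letter_in[of x] by (simp add: free_group_mult_letter)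

lemma inv_letter: "fst x \<in> A \<Longrightarrow> inv\<^bsub>F\<^esub> [x] = [linv x]"
  using letter_in[of x] by (simp add: free_group_inv)

lemma with_inverses_gen: "with_inverses F (gen ` A) = {[x] | x. fst x \<in> A}"
proof
  show "with_inverses F (gen ` A) \<subseteq> {[x] | x. fst x \<in> A}"
    by (auto simp: with_inverses_def gen_def inv_letter linv_def)
  show "{[x] | x. fst x \<in> A} \<subseteq> with_inverses F (gen ` A)"
  proof clarify
    fix a :: 'a and b :: bool assume "fst (a, b) \<in> A"
    then have "[(a, b)] = (if b then gen a else inv\<^bsub>F\<^esub> gen a)"
      by (simp add: gen_def inv_letter linv_def)
    then show "[(a, b)] \<in> with_inverses F (gen ` A)"
      using \<open>fst (a, b) \<in> A\<close> by (auto simp: with_inverses_def)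
  qed
qed

lemma adj_s_iff:
  "adj (cayley F (with_inverses F {s})) u v \<longleftrightarrow>
    u \<in> carrier F \<and> v \<in> carrier F \<and> (v = u \<otimes>\<^bsub>F\<^esub> s \<or> u = v \<otimes>\<^bsub>F\<^esub> s)"
proof -
  have "inv\<^bsub>F\<^esub> u \<otimes>\<^bsub>F\<^esub> v = inv\<^bsub>F\<^esub> s \<longleftrightarrow> u = v \<otimes>\<^bsub>F\<^esub> s" if "u \<in> carrier F" "v \<in> carrier F"
    using inv_solve_left'[of "inv\<^bsub>F\<^esub> s" u v] inv_solve_right[of v u s] that s_in by auto
  then show ?thesis
    using inv_solve_left'[of s u v] s_in by (auto simp: cayley_def with_inverses_def)
qed

lemma adj_iff:
  "adj X u v \<longleftrightarrow> (u \<in> carrier F \<and> v \<in> carrier F \<and> (\<exists>x. fst x \<in> A \<and> v = u \<otimes>\<^bsub>F\<^esub> [x])) \<or>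
    adj (cayley F (with_inverses F {s})) u v"
proof -
  have "inv\<^bsub>F\<^esub> u \<otimes>\<^bsub>F\<^esub> v \<in> with_inverses F (gen ` A) \<longleftrightarrow> (\<exists>x. fst x \<in> A \<and> v = u \<otimes>\<^bsub>F\<^esub> [x])"
    if "u \<in> carrier F" "v \<in> carrier F"
    using inv_solve_left'[OF letter_in that] unfolding with_inverses_gen by blast
  then show ?thesis by (auto simp: cayley_def)
qed

sublocale locally_finite_graph X
proof
  show "symp (adj X)"
  proof (rule sympI)
    fix u v assume "adj X u v"
    then consider x where "u \<in> carrier F" "v \<in> carrier F" "fst x \<in> A" "v = u \<otimes>\<^bsub>F\<^esub> [x]"
      | "adj (cayley F (with_inverses F {s})) u v"
      unfolding adj_iff by blast
    then show "adj X v u"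
    proof cases
      case 1
      then have "v \<otimes>\<^bsub>F\<^esub> [linv x] = u"
        using letter_in[of x] letter_in[of "linv x"] r_one[of u] by (simp add: m_assoc letter_mult_linv free_group_one)
      moreover have "fst (linv x) \<in> A"
        using 1 by (simp add: linv_def)
      ultimately show ?thesis
        using 1 unfolding adj_iff by metis
    qed (auto simp: adj_iff adj_s_iff)
  qed
  show "u \<in> verts X" if "adj X u v" for u v
    using that by (simp add: cayley_def)
  show "finite {v. adj X u v}" for u
  proof (rule finite_subset)
    show "{v. adj X u v} \<subseteq> (\<lambda>y. u \<otimes>\<^bsub>F\<^esub> y) ` (with_inverses F (gen ` A) \<union> with_inverses F {s})"
    proof clarify
      fix v assume "adj X u v"
      then have "u \<in> carrier F" "v \<in> carrier F"
        and y: "inv\<^bsub>F\<^esub> u \<otimes>\<^bsub>F\<^esub> v \<in> with_inverses F (gen ` A) \<union> with_inverses F {s}"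
        by (auto simp: cayley_def)
      then have "v = u \<otimes>\<^bsub>F\<^esub> (inv\<^bsub>F\<^esub> u \<otimes>\<^bsub>F\<^esub> v)"
        using inv_solve_left'[of "inv\<^bsub>F\<^esub> u \<otimes>\<^bsub>F\<^esub> v" u v] by simp
      then show "v \<in> (\<lambda>y. u \<otimes>\<^bsub>F\<^esub> y) ` (with_inverses F (gen ` A) \<union> with_inverses F {s})"
        using y by blast
    qed
    show "finite ((\<lambda>y. u \<otimes>\<^bsub>F\<^esub> y) ` (with_inverses F (gen ` A) \<union> with_inverses F {s}))"
      using finite_A by (simp add: with_inverses_def)
  qed
qed

text \<open>The side containing \<open>g x\<close> of the edge from \<open>g\<close> to \<open>g x\<close> in the Cayley tree of the basis.\<close>

definition side :: "'a word \<Rightarrow> 'a \<times> bool \<Rightarrow> 'a word set" where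
  "side g x = {h \<in> carrier F. starts x (inv\<^bsub>F\<^esub> g \<otimes>\<^bsub>F\<^esub> h)}"

text \<open>An edge \<open>{h, h s}\<close> is indexed by the vertex \<open>h\<close> from which
  \<open>s\<close> is read.\<close>

definition crossing :: "'a word \<Rightarrow> 'a \<times> bool \<Rightarrow> 'a word set" where
  "crossing g x = {h \<in> carrier F. (h \<in> side g x) \<noteq> (h \<otimes>\<^bsub>F\<^esub> s \<in> side g x)}"

text \<open>Oriented with its first end in \<open>side g x\<close>, the form in which
  \<open>two_used_edges\<close> lists cut edges.\<close>

definition crossing_edge :: "'a word \<Rightarrow> 'a \<times> bool \<Rightarrow> 'a word \<Rightarrow> 'a word \<times> 'a word" where
  "crossing_edge g x h = (if h \<in> side g x then (h, h \<otimes>\<^bsub>F\<^esub> s) else (h \<otimes>\<^bsub>F\<^esub> s, h))"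

text \<open>The path from \<open>w\<close> to \<open>w s\<close> spelled by \<open>s\<close> crosses the edge between \<open>1\<close> and \<open>x\<close> at
  an occurrence of \<open>x\<close> or its inverse in \<open>s\<close>, and the position of this occurrence determines \<open>w\<close>.\<close>

lemma crossing_bound: "finite (crossing g x)" "card (crossing g x) \<le> occ (fst x) s"
  if x: "fst x \<in> A" and g: "g \<in> carrier F"
proof -
  \<comment> \<open>The inverse of the map from \<open>h\<close> to the crossed position
    \<open>i\<close>: relative to \<open>g\<close>, the path stands at the identity before reading
    \<open>x\<close> and at \<open>x\<close> before reading its inverse; undoing the prefix
    \<open>take i s\<close> recovers \<open>h\<close>.\<close>
  define \<xi> where "\<xi> i = g \<otimes>\<^bsub>F\<^esub> ((if s ! i = x then [] else [x]) \<otimes>\<^bsub>F\<^esub> inv\<^bsub>F\<^esub> (take i s))" for i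
  have prefix: "take i s \<in> carrier F" for i
    using s_in reduced_append[of "take i s" "drop i s"] set_take_subset[of i s]
    by (auto simp: free_group_carrier_iff)
  have "crossing g x \<subseteq> \<xi> ` {i. i < length s \<and> fst (s ! i) = fst x}"
  proof
    fix h assume "h \<in> crossing g x"
    then have h: "h \<in> carrier F" "(h \<in> side g x) \<noteq> (h \<otimes>\<^bsub>F\<^esub> s \<in> side g x)"
      by (auto simp: crossing_def)
    define w where "w = inv\<^bsub>F\<^esub> g \<otimes>\<^bsub>F\<^esub> h"
    have w: "w \<in> carrier F" "h = g \<otimes>\<^bsub>F\<^esub> w"
      using g h(1) inv_solve_left'[of w g h] by (auto simp: w_def)
    have "starts x w \<noteq> starts x (w \<otimes>\<^bsub>F\<^esub> s)"
      using h g s_in by (simp add: side_def w_def m_assoc)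
    moreover have "w \<otimes>\<^bsub>F\<^esub> take 0 s = w"
      using r_one[OF w(1)] by (simp add: free_group_one)
    ultimately have neq: "starts x (w \<otimes>\<^bsub>F\<^esub> take 0 s) \<noteq> starts x (w \<otimes>\<^bsub>F\<^esub> take (length s) s)"
      by simp
    \<comment> \<open>A discrete intermediate value argument along the prefixes of
      \<open>s\<close>.\<close>
    have "\<exists>i<length s. starts x (w \<otimes>\<^bsub>F\<^esub> take i s) \<noteq> starts x (w \<otimes>\<^bsub>F\<^esub> take (Suc i) s)"
    proof (rule ccontr)
      assume no: "\<not> ?thesis"
      have "starts x (w \<otimes>\<^bsub>F\<^esub> take 0 s) = starts x (w \<otimes>\<^bsub>F\<^esub> take i s)" if "i \<le> length s" for i
        using that by (induction i) (use no in auto)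
      then show False using neq by blast
    qed
    then obtain i where i: "i < length s"
      "starts x (w \<otimes>\<^bsub>F\<^esub> take i s) \<noteq> starts x (w \<otimes>\<^bsub>F\<^esub> take (Suc i) s)"
      by blast
    have letter: "[s ! i] \<in> carrier F"
      using s_in i nth_mem[OF i(1)] by (intro letter_in) (auto simp: free_group_carrier_iff image_subset_iff)
    have "take (Suc i) s = take i s @ [s ! i]"
      using i by (simp add: take_Suc_conv_app_nth)
    then have "take (Suc i) s = take i s \<otimes>\<^bsub>F\<^esub> [s ! i]"
      using prefix[of "Suc i"] by (simp add: free_group_mult_append free_group_carrier_iff)
    then have "w \<otimes>\<^bsub>F\<^esub> take (Suc i) s = (w \<otimes>\<^bsub>F\<^esub> take i s) \<otimes>\<^bsub>F\<^esub> [s ! i]"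
      using w prefix letter by (simp add: m_assoc)
    then have *: "w \<otimes>\<^bsub>F\<^esub> take i s = [] \<and> s ! i = x \<or> w \<otimes>\<^bsub>F\<^esub> take i s = [x] \<and> s ! i = linv x"
      using starts_mult_letter[of "w \<otimes>\<^bsub>F\<^esub> take i s" A x "s ! i"] i w prefix by simp
    then have step: "w \<otimes>\<^bsub>F\<^esub> take i s = (if s ! i = x then [] else [x])"
      by auto
    have "w = (w \<otimes>\<^bsub>F\<^esub> take i s) \<otimes>\<^bsub>F\<^esub> inv\<^bsub>F\<^esub> (take i s)"
      using w(1) prefix[of i] by (simp add: m_assoc)
    then have "w = (if s ! i = x then [] else [x]) \<otimes>\<^bsub>F\<^esub> inv\<^bsub>F\<^esub> (take i s)"
      unfolding step .
    moreover have "fst (s ! i) = fst x"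
      using * by (auto simp: linv_def)
    ultimately show "h \<in> \<xi> ` {i. i < length s \<and> fst (s ! i) = fst x}"
      using i w(2) by (auto simp: \<xi>_def)
  qed
  from finite_subset[OF this] surj_card_le[OF _ this]
  show "finite (crossing g x)" "card (crossing g x) \<le> occ (fst x) s"
    by (simp_all add: occ_eq_card)
qed

text \<open>By \<open>starts_mult_letter\<close>, the edge \<open>{g, g x}\<close> is the only tree
  edge across the cut; the \<open>s\<close>-edges across it are collected in \<open>crossing\<close>
  by definition.\<close>

lemma cut_edges:
  assumes x: "fst x \<in> A" and g: "g \<in> carrier F" and uv: "adj X u v" "u \<in> side g x" "v \<notin> side g x"
  shows "(u, v) = (g \<otimes>\<^bsub>F\<^esub> [x], g) \<or> (\<exists>h\<in>crossing g x. (u, v) = crossing_edge g x h)"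
proof -
  have carrier: "u \<in> carrier F" "v \<in> carrier F"
    using uv(1) by (auto simp: cayley_def)
  from uv(1) consider z where "fst z \<in> A" "v = u \<otimes>\<^bsub>F\<^esub> [z]" | "v = u \<otimes>\<^bsub>F\<^esub> s" | "u = v \<otimes>\<^bsub>F\<^esub> s"
    unfolding adj_iff adj_s_iff by blast
  then show ?thesis
  proof cases
    case 1
    have starts: "starts x (inv\<^bsub>F\<^esub> g \<otimes>\<^bsub>F\<^esub> u)" "\<not> starts x ((inv\<^bsub>F\<^esub> g \<otimes>\<^bsub>F\<^esub> u) \<otimes>\<^bsub>F\<^esub> [z])"
      using uv(2,3) 1 carrier g letter_in[of z] by (simp_all add: side_def m_assoc)
    then have *: "inv\<^bsub>F\<^esub> g \<otimes>\<^bsub>F\<^esub> u = [x]" "z = linv x"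
      using starts_mult_letter[of "inv\<^bsub>F\<^esub> g \<otimes>\<^bsub>F\<^esub> u" A x z] carrier g by auto
    then have "u = g \<otimes>\<^bsub>F\<^esub> [x]"
      using inv_solve_left' g carrier letter_in[OF x] by blast
    moreover have "v = g"
      using 1 * \<open>u = g \<otimes>\<^bsub>F\<^esub> [x]\<close> g letter_in[OF x] letter_in[of z] r_one[OF g]
      by (simp add: m_assoc letter_mult_linv x free_group_one)
    ultimately show ?thesis by simp
  next
    case 2
    then show ?thesis
      using uv carrier by (auto simp: crossing_def crossing_edge_def)
  next
    case 3
    then show ?thesis
      using uv carrier by (auto simp: crossing_def crossing_edge_def)
  qed
qed

lemma finite_boundary_side:
  assumes "fst x \<in> A" "g \<in> carrier F"
  shows "finite (boundary X (side g x))"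
proof (rule finite_subset)
  let ?E = "insert (g \<otimes>\<^bsub>F\<^esub> [x], g) (crossing_edge g x ` crossing g x)"
  show "boundary X (side g x) \<subseteq> fst ` ?E \<union> snd ` ?E"
  proof
    fix u assume "u \<in> boundary X (side g x)"
    then obtain v where "adj X u v" "(u \<in> side g x) \<noteq> (v \<in> side g x)"
      using adj_sym by (auto simp: boundary_def)
    then have "(u, v) \<in> ?E \<or> (v, u) \<in> ?E"
      using cut_edges[OF assms] adj_sym by blast
    then show "u \<in> fst ` ?E \<union> snd ` ?E" by (metis UnCI fst_conv snd_conv image_eqI)
  qed
qed (use crossing_bound[OF assms] in simp)

lemma side_ends:
  assumes "fst x \<in> A" "g \<in> carrier F"
  shows "g \<otimes>\<^bsub>F\<^esub> [x] \<in> side g x" "g \<notin> side g x"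
proof -
  have "inv\<^bsub>F\<^esub> g \<otimes>\<^bsub>F\<^esub> (g \<otimes>\<^bsub>F\<^esub> [x]) = [x]"
    using assms letter_in[of x] by (simp add: inv_solve_left')
  then show "g \<otimes>\<^bsub>F\<^esub> [x] \<in> side g x"
    using assms letter_in[of x] by (simp add: side_def)
  show "g \<notin> side g x"
    using assms by (simp add: side_def l_inv free_group_one)
qed

end

locale free_word_curve = free_word_graph A s +
  vertex_curve "cayley (free_group A)
    (with_inverses (free_group A) (gen ` A) \<union> with_inverses (free_group A) {s})" \<gamma>
  for A :: "'a set" and s :: "'a word" and \<gamma> :: "real \<Rightarrow> 'a word fpoint" +
  assumes card_A: "card A \<ge> 2" and occ_le: "a \<in> A \<Longrightarrow> occ a s \<le> 2"
begin

text \<open>The pair \<open>e\<close> may be arbitrary, so the case of a cut without any used edge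
  is covered as well.\<close>

lemma cut_two_used:
  assumes x: "fst x \<in> A" and g: "g \<in> carrier F"
    and tree: "used g (g \<otimes>\<^bsub>F\<^esub> [x]) \<Longrightarrow> (g \<otimes>\<^bsub>F\<^esub> [x], g) = e"
    and cross: "\<And>h. h \<in> crossing g x \<Longrightarrow> used h (h \<otimes>\<^bsub>F\<^esub> s) \<Longrightarrow> crossing_edge g x h = e"
  shows False
proof (rule two_used_edges[OF finite_boundary_side[OF x g] _ side_ends(1)[OF x g] _ side_ends(2)[OF x g]])
  show "(u, v) = e" if "used u v" "u \<in> side g x" "v \<notin> side g x" for u v
  proof -
    have "adj X u v" using that(1) by (simp add: used_def)
    from cut_edges[OF x g this that(2,3)] show ?thesis
    proof
      assume "(u, v) = (g \<otimes>\<^bsub>F\<^esub> [x], g)"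
      then show ?thesis using tree used_sym that(1) by simp
    next
      assume "\<exists>h\<in>crossing g x. (u, v) = crossing_edge g x h"
      then obtain h where "h \<in> crossing g x" "(u, v) = crossing_edge g x h" by blast
      moreover have "used h (h \<otimes>\<^bsub>F\<^esub> s)"
        using \<open>(u, v) = crossing_edge g x h\<close> that(1) used_sym
        by (auto simp: crossing_edge_def split: if_splits)
      ultimately show ?thesis using cross by simp
    qed
  qed
qed (use g letter_in[OF x] in \<open>simp_all add: cayley_def\<close>)

text \<open>Every generator occurs in \<open>s\<close>: a cut at a missing generator would consist
  of its tree edge alone, while the circle needs two edges. Hence the length of \<open>s\<close> is
  at least \<open>card A\<close>.\<close>

lemma s_long: obtains x y q where "s = x # y # q"
proof -
  have "a \<in> fst ` set s" if "a \<in> A" for a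
  proof (rule ccontr)
    assume "a \<notin> fst ` set s"
    then have "{i. i < length s \<and> fst (s ! i) = a} = {}"
      by (metis (mono_tags, lifting) empty_Collect_eq image_eqI nth_mem)
    then have "occ a s = 0"
      by (metis card.empty occ_eq_card)
    then have "crossing [] (a, True) = {}"
      using crossing_bound[of "(a, True)" "[]"] that one_closed by (simp add: free_group_one)
    then show False
      using cut_two_used[of "(a, True)" "[]" "([] \<otimes>\<^bsub>F\<^esub> [(a, True)], [])"] that one_closed
      by (simp add: free_group_one)
  qed
  then have "card A \<le> card (fst ` set s)"
    by (intro card_mono) auto
  also have "\<dots> \<le> length s"
    using card_image_le[of "set s" fst] card_length[of s] by simp
  finally show thesis
    using card_A that by (cases s; cases "tl s") auto
qed

lemma unused_tree_edge:
  assumes x: "fst x \<in> A" and g: "g \<in> carrier F"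
    and h: "h \<in> crossing g x" "\<not> used h (h \<otimes>\<^bsub>F\<^esub> s)"
  shows "used g (g \<otimes>\<^bsub>F\<^esub> [x])"
proof (rule ccontr)
  assume no: "\<not> used g (g \<otimes>\<^bsub>F\<^esub> [x])"
  have "card (crossing g x - {h}) \<le> Suc 0"
    using crossing_bound[OF x g] occ_le[OF x] h(1) by simp
  then have "h1 = h2" if "h1 \<in> crossing g x - {h}" "h2 \<in> crossing g x - {h}" for h1 h2
    using that crossing_bound(1)[OF x g] by (simp add: card_le_Suc0_iff_eq)
  \<comment> \<open>If no other crossing remains, the condition is vacuous and \<open>e\<close> is
    arbitrary.\<close>
  then have "\<exists>e. \<forall>h'\<in>crossing g x - {h}. crossing_edge g x h' = e"
    by metis
  then obtain e where "\<And>h'. h' \<in> crossing g x \<Longrightarrow> h' \<noteq> h \<Longrightarrow> crossing_edge g x h' = e"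
    by blast
  then show False
    using cut_two_used[OF x g, of e] no h(2) by metis
qed

lemma unused_unique:
  assumes x: "fst x \<in> A" and g: "g \<in> carrier F"
    and h: "h \<in> crossing g x" "\<not> used h (h \<otimes>\<^bsub>F\<^esub> s)"
    and h': "h' \<in> crossing g x" "\<not> used h' (h' \<otimes>\<^bsub>F\<^esub> s)"
  shows "h = h'"
proof (rule ccontr)
  assume "h \<noteq> h'"
  then have "crossing g x = {h, h'}"
    using crossing_bound[OF x g] occ_le[OF x] h(1) h'(1)
    by (intro card_seteq[symmetric]) auto
  show False
  proof (rule cut_two_used[OF x g refl])
    show "crossing_edge g x k = (g \<otimes>\<^bsub>F\<^esub> [x], g)"
      if "k \<in> crossing g x" "used k (k \<otimes>\<^bsub>F\<^esub> s)" for k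
      using that h(2) h'(2) unfolding \<open>crossing g x = {h, h'}\<close> by blast
  qed
qed

lemma degree_le_2:
  assumes v: "v \<in> carrier F" and "y1 \<in> carrier F" "y2 \<in> carrier F" "y3 \<in> carrier F"
    and "used v (v \<otimes>\<^bsub>F\<^esub> y1)" "used v (v \<otimes>\<^bsub>F\<^esub> y2)" "used v (v \<otimes>\<^bsub>F\<^esub> y3)"
    and "[] \<notin> {y1, y2, y3}" "y1 \<noteq> y2" "y1 \<noteq> y3"
  shows "y2 = y3"
proof (rule ccontr)
  assume "y2 \<noteq> y3"
  have "v \<noteq> v \<otimes>\<^bsub>F\<^esub> y" if "y \<in> carrier F" "y \<noteq> []" for y
    using l_cancel_one'[of v y] that v by (simp add: free_group_one)
  then show False
    using assms \<open>y2 \<noteq> y3\<close>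
    by (intro used_degree_le_2[of v "v \<otimes>\<^bsub>F\<^esub> y1" "v \<otimes>\<^bsub>F\<^esub> y2" "v \<otimes>\<^bsub>F\<^esub> y3"])
      (auto simp: free_group_one)
qed

text \<open>If the edge from \<open>h\<close> to \<open>h s\<close> were unused, then all edges of the tree path spelled by \<open>s\<close>
  from \<open>h\<close> would be used, so its second vertex \<open>v\<close> would have no further used edges.
  Then also the edge from \<open>v\<close> to \<open>v s\<close> is unused, and both unused edges cross the same cut.\<close>

lemma used_s:
  assumes h: "h \<in> carrier F"
  shows "used h (h \<otimes>\<^bsub>F\<^esub> s)"
proof (rule ccontr)
  assume unused: "\<not> used h (h \<otimes>\<^bsub>F\<^esub> s)"
  obtain x y q where s: "s = x # y # q" by (rule s_long)
  have x: "fst x \<in> A" and y: "fst y \<in> A" and xy: "y \<noteq> linv x" and yq: "y # q \<in> carrier F"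
    using s_in by (auto simp: s free_group_carrier_iff reduced_Cons)
  have linv_x: "fst (linv x) \<in> A" using x by (simp add: linv_def)
  have s_mult: "s = [x] \<otimes>\<^bsub>F\<^esub> (y # q)"
    using s_in by (simp add: s free_group_mult_append free_group_carrier_iff)
  define v where "v = h \<otimes>\<^bsub>F\<^esub> [x]"
  have v: "v \<in> carrier F" using h letter_in[OF x] by (simp add: v_def)
  have hv: "h = v \<otimes>\<^bsub>F\<^esub> [linv x]"
    using h letter_in[OF x] letter_in[OF linv_x] r_one[OF h]
    by (simp add: v_def m_assoc letter_mult_linv x free_group_one)
  \<comment> \<open>The first letter of \<open>s\<close> is \<open>x\<close>, so the path spelled
    from \<open>g\<close> leaves through the edge to \<open>g x\<close>, and reducedness prevents a
    return.\<close>
  have self_crossing: "g \<in> crossing g x" if g: "g \<in> carrier F" for g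
  proof -
    have "inv\<^bsub>F\<^esub> g \<otimes>\<^bsub>F\<^esub> (g \<otimes>\<^bsub>F\<^esub> s) = s"
      using g s_in by (simp add: inv_solve_left')
    then show ?thesis
      using side_ends(2)[OF x g] g s_in by (simp add: crossing_def side_def) (simp add: s)
  qed
  \<comment> \<open>The second edge of the path from \<open>h\<close> is \<open>{v, v y}\<close>.
    Seen from \<open>v\<close>, the path begins at \<open>linv x\<close>, outside the branch of
    \<open>y\<close>, and ends at \<open>y # q\<close>, inside it.\<close>
  have h_crossing: "h \<in> crossing v y"
  proof -
    have "inv\<^bsub>F\<^esub> v \<otimes>\<^bsub>F\<^esub> h = [linv x]"
      using v h hv letter_in[OF linv_x] by (simp add: inv_solve_left')
    moreover have "inv\<^bsub>F\<^esub> v \<otimes>\<^bsub>F\<^esub> (h \<otimes>\<^bsub>F\<^esub> s) = y # q"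
      using v h s_in yq letter_in[OF x] by (simp add: inv_solve_left') (simp add: s_mult v_def m_assoc)
    ultimately show ?thesis
      using h s_in xy by (auto simp: crossing_def side_def)
  qed
  have "used h v"
    using unused_tree_edge[OF x h self_crossing[OF h] unused] by (simp add: v_def)
  then have used1: "used v (v \<otimes>\<^bsub>F\<^esub> [linv x])"
    using used_sym hv by simp
  have used2: "used v (v \<otimes>\<^bsub>F\<^esub> [y])"
    by (rule unused_tree_edge[OF y v h_crossing unused])
  \<comment> \<open>The neighbours \<open>v (linv x)\<close> and \<open>v y\<close> exhaust the
    degree of \<open>v\<close>, and \<open>s\<close>, having at least two letters, is neither of
    these letters.\<close>
  have unused_v: "\<not> used v (v \<otimes>\<^bsub>F\<^esub> s)"
    using degree_le_2[OF v letter_in[OF linv_x] letter_in[OF y] s_in used1 used2] xy by (auto simp: s)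
  then have "used v (v \<otimes>\<^bsub>F\<^esub> [x])"
    by (rule unused_tree_edge[OF x v self_crossing[OF v]])
  then have "y = x"
    using degree_le_2[OF v letter_in[OF linv_x] letter_in[OF y] letter_in[OF x] used1 used2] xy by auto
  then have "h = v"
    using unused_unique[OF y v h_crossing unused _ unused_v] self_crossing[OF v] by simp
  then show False
    using hv l_cancel_one'[of v "[linv x]"] v letter_in[OF linv_x] by (simp add: free_group_one)
qed

text \<open>By \<open>used_s\<close>, the edges from \<open>u\<close> to \<open>u s\<close> and to
  \<open>u\<close> times the inverse of \<open>s\<close> are both used. They are distinct, so the
  degree bound admits no further edge.\<close>

lemma used_iff: "used u v \<longleftrightarrow> adj (cayley F (with_inverses F {s})) u v"
proof
  assume uv: "used u v"
  then have adj: "adj X u v" by (simp add: used_def)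
  then have carrier: "u \<in> carrier F" "v \<in> carrier F"
    by (simp_all add: cayley_def)
  have s_nonempty: "s \<noteq> []" by (rule s_long) simp
  have inv_s: "inv\<^bsub>F\<^esub> s \<in> carrier F" "inv\<^bsub>F\<^esub> s \<noteq> []" "s \<noteq> inv\<^bsub>F\<^esub> s"
    using s_in s_nonempty reduced_neq_inverse[of s] inv_closed[OF s_in]
    by (auto simp: free_group_inv free_group_carrier_iff)
  define y where "y = inv\<^bsub>F\<^esub> u \<otimes>\<^bsub>F\<^esub> v"
  have y: "y \<in> carrier F" "v = u \<otimes>\<^bsub>F\<^esub> y"
    using carrier inv_solve_left'[of y u v] by (auto simp: y_def)
  have "y \<in> with_inverses F (gen ` A) \<union> with_inverses F {s}"
    using adj by (simp add: cayley_def y_def)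
  then have "y \<noteq> []"
    using s_nonempty inv_s(2) unfolding with_inverses_gen by (auto simp: with_inverses_def)
  have "u \<otimes>\<^bsub>F\<^esub> inv\<^bsub>F\<^esub> s \<otimes>\<^bsub>F\<^esub> s = u"
    using carrier s_in by (simp add: m_assoc)
  then have "used u (u \<otimes>\<^bsub>F\<^esub> inv\<^bsub>F\<^esub> s)"
    using used_s[of "u \<otimes>\<^bsub>F\<^esub> inv\<^bsub>F\<^esub> s"] carrier s_in used_sym by simp
  then have "y = s \<or> y = inv\<^bsub>F\<^esub> s"
    using degree_le_2[OF carrier(1) y(1) s_in inv_s(1)] uv used_s[OF carrier(1)] y(2) inv_s
      s_nonempty \<open>y \<noteq> []\<close> by auto
  then show "adj (cayley F (with_inverses F {s})) u v"
    using carrier by (auto simp: cayley_def with_inverses_def y_def)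
next
  assume "adj (cayley F (with_inverses F {s})) u v"
  then show "used u v"
    using used_s used_sym by (auto simp: adj_s_iff)
qed

lemma range_Int_graph_points:
  "range \<gamma> \<inter> graph_points X = graph_points (cayley F (with_inverses F {s}))" (is "_ = graph_points ?Y")
proof
  have verts: "verts ?Y = verts X" "verts X = carrier F"
    by (simp_all add: cayley_def)
  show "range \<gamma> \<inter> graph_points X \<subseteq> graph_points ?Y"
  proof
    fix z assume z: "z \<in> range \<gamma> \<inter> graph_points X"
    then have "z \<in> graph_points X" by blast
    then show "z \<in> graph_points ?Y"
    proof (cases rule: graph_points_cases)
      case (1 v)
      then show ?thesis by (simp add: graph_points_def verts)
    next
      case (2 u v t)
      then have "adj ?Y u v"
        using usedI[of u v t] z used_iff by blast
      then have "u \<in> verts ?Y \<and> v \<in> verts ?Y \<and> adj ?Y u v \<and> t \<in> {0..1}"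
        using 2 by (simp add: adj_s_iff verts)
      then show ?thesis
        using 2(5) unfolding graph_points_def by blast
    qed
  qed
  show "graph_points ?Y \<subseteq> range \<gamma> \<inter> graph_points X"
  proof
    fix z assume "z \<in> graph_points ?Y"
    then show "z \<in> range \<gamma> \<inter> graph_points X"
    proof (cases rule: graph_points_cases)
      case (1 v)
      then show ?thesis
        using vertex_in_range by (simp add: graph_points_def verts)
    next
      case (2 u v t)
      then have "used u v" by (simp add: used_iff)
      then show ?thesis
        using used_edge_subset[of u v t] edge_point_in_graph_points[of u v t] 2 by (simp add: used_def)
    qed
  qed
qed

text \<open>The right-hand side does not depend on \<open>\<gamma>\<close>; this independence is the
  uniqueness of the circle as a point set.\<close>

lemma range_eq: "range \<gamma> = graph_points (cayley F (with_inverses F {s})) \<union> End ` ends X"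
proof -
  have "range \<gamma> \<subseteq> graph_points X \<union> End ` ends X"
    using \<gamma>_in_topspace topspace_freudenthal[OF symp_adj] by blast
  then show ?thesis
    using range_Int_graph_points ends_in_range by blast
qed

end

theorem theorem5p6:
  fixes n :: nat and A :: "'a set" and s :: "'a word"
  defines "F \<equiv> free_group A"
  defines "X \<equiv> cayley F (with_inverses F (gen ` A) \<union> with_inverses F {s})"
  assumes "n \<ge> 2" and "finite A" and "card A = n"
    and "s \<in> carrier F"
    and "\<And>a. a \<in> A \<Longrightarrow> occ a s \<le> 2"
    and "\<exists>C. hamiltonian_circle X C"
  shows "\<exists>C. (\<forall>D. hamiltonian_circle X D \<longleftrightarrow> D = C) \<and>
    C \<inter> graph_points X = graph_points (cayley F (with_inverses F {s}))"
proof -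
  interpret G: free_word_graph A s
    using assms by unfold_locales (auto simp: F_def)
  let ?C = "graph_points (cayley F (with_inverses F {s})) \<union> End ` ends X"
  have circle: "D = ?C \<and> D \<inter> graph_points X = graph_points (cayley F (with_inverses F {s}))"
    if D: "hamiltonian_circle X D" for D
  proof -
    obtain \<gamma> where \<gamma>: "vertex_curve X \<gamma>" "range \<gamma> = D"
      using G.hamiltonian_circle_curve D unfolding X_def F_def by metis
    interpret free_word_curve A s \<gamma>
      using \<gamma>(1) assms unfolding X_def F_def
      by (intro free_word_curve.intro free_word_curve_axioms.intro G.free_word_graph_axioms) auto
    show ?thesis
      using range_eq range_Int_graph_points \<gamma>(2) by (simp add: X_def F_def)
  qed
  with \<open>\<exists>C. hamiltonian_circle X C\<close> show ?thesis by metis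
qed

end
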